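(* Let $\Lambda>0$. Let $(M,g)$ be the standard Nariai solution $$M=\mathbb R\times(\mathbb S^1\times\mathbb S^2),\qquad g=\frac1\Lambda\left(-dt^2+\cosh^2 t\,d\rho^2+g_{\mathbb S^2}\right).$$ Then $(M,g)$ does not have even a patch of a smooth conformal boundary. The same is true for its universal cover, i.e. for $\mathbb R\times(\mathbb R\times\mathbb S^2)$ with the metric given by the same formula.
   Context: Here $t\in\mathbb R$, $\rho$ is the standard coordinate on $\mathbb S^1$ (respectively the coordinate on $\mathbb R$ for the universal cover), and $g_{\mathbb S^2}$ is the standard round unit metric on $\mathbb S^2$. The metric $g$ solves the vacuum Einstein equations $G_{\mu\nu}+\Lambda g_{\mu\nu}=0$. A Lorentzian manifold $(M,g)$ has a patch of a smooth conformal boundary if there is a triple $(\tilde M,\tilde g,\Omega)$, called a smooth conformal extension, such that: $\tilde M$ is a smooth manifold with non-empty boundary $\partial\tilde M$, whose interior is identified with $M$; $\tilde g$ is a smooth Lorentzian metric on $\tilde M$ (smooth up to and including the boundary); $\Omega$ is a smooth function on $\tilde M$ which is strictly positive on $M$ and satisfies $\Omega=0$ and $d\Omega\neq0$ on $\partial\tilde M$; and $g=\Omega^{-2}\tilde g$ on $M$. Neither $\tilde M$ nor $\partial\tilde M$ is required to be compact: the boundary may be just an open patch. (For solutions of the vacuum field equations with $\Lambda>0$ such a boundary is automatically spacelike with respect to $\tilde g$ and corresponds to the infinite timelike future or past.) *)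

theory Defs
  imports "HOL-Analysis.Analysis"
begin

section \<open>Smooth maps on subsets of Euclidean spaces\<close>

text \<open>\<open>Ck_on k S f\<close> is only meant for open \<open>S\<close>: the derivatives are full, not one-sided.\<close>

primrec Ck_on :: "nat \<Rightarrow> 'a::euclidean_space set \<Rightarrow> ('a \<Rightarrow> 'b::euclidean_space) \<Rightarrow> bool" where
  "Ck_on 0 S f \<longleftrightarrow> continuous_on S f"
| "Ck_on (Suc k) S f \<longleftrightarrow>
     (\<forall>x\<in>S. f differentiable (at x)) \<and>
     (\<forall>v. Ck_on k S (\<lambda>x. frechet_derivative f (at x) v))"

text \<open>On an arbitrary set, a map is smooth if it extends locally to a smooth map on an open set.
  For relatively open subsets of a half-space this is smoothness up to and including the boundary.\<close>

definition smooth_on :: "'a::euclidean_space set \<Rightarrow> ('a \<Rightarrow> 'b::euclidean_space) \<Rightarrow> bool" where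
  "smooth_on S f \<longleftrightarrow>
     (\<forall>x\<in>S. \<exists>U F. open U \<and> x \<in> U \<and> (\<forall>k. Ck_on k U F) \<and> (\<forall>y\<in>S \<inter> U. F y = f y))"

section \<open>Smooth manifolds with boundary\<close>

type_synonym ('a, 'n) chart = "'a set \<times> ('a \<Rightarrow> real^'n)"

text \<open>Charts of a manifold with boundary take values in the following half-space, charts of a
  manifold without boundary in \<open>UNIV\<close>; both cases are covered by a parameter \<open>H\<close>. The index \<open>1\<close> is
  an arbitrary element of the index type (for a numeral type \<open>4\<close> the indices are \<open>1, 2, 3, 4\<close>).\<close>

definition half_space :: "(real^'n::{finite,one}) set" where
  "half_space = {x. 0 \<le> x $ 1}"

definition is_chart :: "(real^'n::finite) set \<Rightarrow> 'a topology \<Rightarrow> ('a, 'n) chart \<Rightarrow> bool" where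
  "is_chart H X = (\<lambda>(U, \<phi>).
     openin X U \<and> openin (top_of_set H) (\<phi> ` U) \<and>
     homeomorphic_map (subtopology X U) (top_of_set (\<phi> ` U)) \<phi>)"

definition transition :: "('a, 'n::finite) chart \<Rightarrow> ('a, 'n) chart \<Rightarrow> real^'n \<Rightarrow> real^'n" where
  "transition c d = snd d \<circ> inv_into (fst c) (snd c)"

text \<open>The atlas need not be maximal.\<close>

definition smooth_manifold :: "(real^'n::finite) set \<Rightarrow> 'a topology \<Rightarrow> ('a, 'n) chart set \<Rightarrow> bool"
  where
  "smooth_manifold H X A \<longleftrightarrow>
     Hausdorff_space X \<and> second_countable X \<and>
     (\<forall>c\<in>A. is_chart H X c) \<and> \<Union> (fst ` A) = topspace X \<and>
     (\<forall>c\<in>A. \<forall>d\<in>A. smooth_on (snd c ` (fst c \<inter> fst d)) (transition c d))"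

definition mfd_boundary :: "('a, 'n::{finite,one}) chart set \<Rightarrow> 'a set" where
  "mfd_boundary A = {p. \<exists>(U, \<phi>)\<in>A. p \<in> U \<and> \<phi> p \<in> frontier half_space}"

definition mfd_interior :: "('a, 'n::{finite,one}) chart set \<Rightarrow> 'a set" where
  "mfd_interior A = {p. \<exists>(U, \<phi>)\<in>A. p \<in> U \<and> \<phi> p \<in> interior half_space}"

definition restrict_atlas :: "('a, 'n::finite) chart set \<Rightarrow> 'a set \<Rightarrow> ('a, 'n) chart set" where
  "restrict_atlas A S = (\<lambda>(U, \<phi>). (U \<inter> S, \<phi>)) ` A"

definition smooth_function :: "('a, 'n::finite) chart set \<Rightarrow> ('a \<Rightarrow> real) \<Rightarrow> bool" where
  "smooth_function A f \<longleftrightarrow> (\<forall>(U, \<phi>)\<in>A. smooth_on (\<phi> ` U) (f \<circ> inv_into U \<phi>))"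

definition smooth_map ::
  "'a topology \<Rightarrow> ('a, 'm::finite) chart set \<Rightarrow> 'b topology \<Rightarrow> ('b, 'n::finite) chart set
    \<Rightarrow> ('a \<Rightarrow> 'b) \<Rightarrow> bool" where
  "smooth_map X A Y B f \<longleftrightarrow>
     continuous_map X Y f \<and>
     (\<forall>(U, \<phi>)\<in>A. \<forall>(V, \<psi>)\<in>B. smooth_on (\<phi> ` (U \<inter> f -` V)) (\<psi> \<circ> f \<circ> inv_into U \<phi>))"

definition diffeomorphism ::
  "'a topology \<Rightarrow> ('a, 'm::finite) chart set \<Rightarrow> 'b topology \<Rightarrow> ('b, 'n::finite) chart set
    \<Rightarrow> ('a \<Rightarrow> 'b) \<Rightarrow> bool" where
  "diffeomorphism X A Y B f \<longleftrightarrow>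
     bij_betw f (topspace X) (topspace Y) \<and> smooth_map X A Y B f \<and>
     smooth_map Y B X A (inv_into (topspace X) f)"

section \<open>Lorentzian metrics\<close>

text \<open>A covariant 2-tensor field is given by its coordinate representations: \<open>g c p u v\<close> is the value
  at the point \<open>p\<close> on the two tangent vectors with components \<open>u\<close>, \<open>v\<close> in the chart \<open>c\<close>.\<close>

type_synonym ('a, 'n) tensor2 = "('a, 'n) chart \<Rightarrow> 'a \<Rightarrow> real^'n \<Rightarrow> real^'n \<Rightarrow> real"

text \<open>Signature \<open>(-,+,\<dots>,+)\<close>: there is a pseudo-orthonormal basis with exactly one timelike vector.\<close>

definition lorentzian_form :: "('v::euclidean_space \<Rightarrow> 'v \<Rightarrow> real) \<Rightarrow> bool" where
  "lorentzian_form b \<longleftrightarrow>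
     bilinear b \<and> (\<forall>u v. b u v = b v u) \<and>
     (\<exists>E. \<exists>e\<in>E. independent E \<and> span E = UNIV \<and> b e e = -1 \<and> (\<forall>x\<in>E - {e}. b x x = 1) \<and>
        (\<forall>x\<in>E. \<forall>y\<in>E. x \<noteq> y \<longrightarrow> b x y = 0))"

text \<open>The derivative of a transition map is taken within the image of the chart overlap; at boundary
  points it is one-sided, and still unique.\<close>

definition lorentzian_metric :: "('a, 'n::finite) chart set \<Rightarrow> ('a, 'n) tensor2 \<Rightarrow> bool" where
  "lorentzian_metric A g \<longleftrightarrow>
     (\<forall>c\<in>A. \<forall>p\<in>fst c. lorentzian_form (g c p)) \<and>
     (\<forall>(U, \<phi>)\<in>A. \<forall>u v. smooth_on (\<phi> ` U) (\<lambda>x. g (U, \<phi>) (inv_into U \<phi> x) u v)) \<and>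
     (\<forall>c\<in>A. \<forall>d\<in>A. \<forall>p\<in>fst c \<inter> fst d.
        let D = frechet_derivative (transition c d) (at (snd c p) within snd c ` (fst c \<inter> fst d))
        in \<forall>u v. g c p u v = g d p (D u) (D v))"

section \<open>Smooth conformal extensions\<close>

text \<open>The interior of the extension \<open>(X', A')\<close> is identified with \<open>(X, A)\<close> through the
  diffeomorphism \<open>\<iota>\<close>, and the last condition reads \<open>g = \<iota>\<^sup>* (\<Omega>\<^sup>-\<^sup>2 g')\<close>.\<close>

definition smooth_conformal_extension ::
  "'a topology \<Rightarrow> ('a, 'n::{finite,one}) chart set \<Rightarrow> ('a, 'n) tensor2
    \<Rightarrow> 'b topology \<Rightarrow> ('b, 'n) chart set \<Rightarrow> ('a \<Rightarrow> 'b) \<Rightarrow> ('b, 'n) tensor2 \<Rightarrow> ('b \<Rightarrow> real) \<Rightarrow> bool"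
  where
  "smooth_conformal_extension X A g X' A' \<iota> g' \<Omega> \<longleftrightarrow>
     smooth_manifold half_space X' A' \<and>
     mfd_boundary A' \<noteq> {} \<and>
     diffeomorphism X A (subtopology X' (mfd_interior A')) (restrict_atlas A' (mfd_interior A')) \<iota> \<and>
     lorentzian_metric A' g' \<and>
     smooth_function A' \<Omega> \<and>
     (\<forall>q\<in>mfd_interior A'. \<Omega> q > 0) \<and>
     (\<forall>q\<in>mfd_boundary A'. \<Omega> q = 0) \<and>
     (\<forall>q\<in>mfd_boundary A'. \<forall>(V, \<psi>)\<in>A'. q \<in> V \<longrightarrow>
        frechet_derivative (\<Omega> \<circ> inv_into V \<psi>) (at (\<psi> q) within \<psi> ` V) \<noteq> (\<lambda>_. 0)) \<and>
     (\<forall>(U, \<phi>)\<in>A. \<forall>(V, \<psi>)\<in>A'. \<forall>p\<in>U. \<iota> p \<in> V \<longrightarrow>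
        (let D = frechet_derivative (\<psi> \<circ> \<iota> \<circ> inv_into U \<phi>) (at (\<phi> p) within \<phi> ` (U \<inter> \<iota> -` V))
         in \<forall>u v. g (U, \<phi>) p u v = g' (V, \<psi>) (\<iota> p) (D u) (D v) / (\<Omega> (\<iota> p))\<^sup>2))"

text \<open>A type cannot be quantified over inside a formula, so the type of the points of the extension
  is an explicit argument. Every smooth manifold with boundary has at most continuum many points.\<close>

definition has_conformal_boundary_patch ::
  "'b itself \<Rightarrow> 'a topology \<Rightarrow> ('a, 'n::{finite,one}) chart set \<Rightarrow> ('a, 'n) tensor2 \<Rightarrow> bool" where
  "has_conformal_boundary_patch T X A g \<longleftrightarrow>
     (\<exists>(X' :: 'b topology) A' \<iota> g' \<Omega>. smooth_conformal_extension X A g X' A' \<iota> g' \<Omega>)"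

section \<open>Submanifolds of Euclidean spaces\<close>

text \<open>The maximal atlas of an embedded submanifold \<open>S\<close>: all diffeomorphisms, in the sense of
  \<open>smooth_on\<close>, from relatively open subsets of \<open>S\<close> onto open subsets of the model space.\<close>

definition submanifold_atlas :: "'e::euclidean_space set \<Rightarrow> ('e, 'n::finite) chart set" where
  "submanifold_atlas S = {(U, \<phi>). openin (top_of_set S) U \<and> open (\<phi> ` U) \<and> inj_on \<phi> U \<and>
     smooth_on U \<phi> \<and> smooth_on (\<phi> ` U) (inv_into U \<phi>)}"

text \<open>Restriction of a field \<open>G\<close> of bilinear forms on the ambient space to the tangent spaces.\<close>

definition induced_tensor ::
  "('e::euclidean_space \<Rightarrow> 'e \<Rightarrow> 'e \<Rightarrow> real) \<Rightarrow> ('e, 'n::finite) tensor2" where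
  "induced_tensor G = (\<lambda>(U, \<phi>) p u v.
     let D = frechet_derivative (inv_into U \<phi>) (at (\<phi> p)) in G p (D u) (D v))"

section \<open>The Nariai solution\<close>

text \<open>The factor \<open>C\<close> is either the unit circle in \<open>complex\<close> or the real line. The inner product
  of the ambient space restricts to \<open>d\<rho>\<^sup>2\<close> in both cases (on the circle \<open>\<rho> \<mapsto> cis \<rho>\<close> has unit speed),
  and to the round unit metric on the sphere in \<open>real^3\<close>.\<close>

definition nariai_space :: "'r::euclidean_space set \<Rightarrow> (real \<times> 'r \<times> (real^3)) set" where
  "nariai_space C = UNIV \<times> C \<times> sphere 0 1"

fun nariai_form :: "real \<Rightarrow> real \<times> 'r::euclidean_space \<times> (real^3) \<Rightarrow> real \<times> 'r \<times> (real^3)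
    \<Rightarrow> real \<times> 'r \<times> (real^3) \<Rightarrow> real" where
  "nariai_form \<Lambda> (t, z, x) (\<tau>, \<zeta>, \<xi>) (\<tau>', \<zeta>', \<xi>') =
     1 / \<Lambda> * (- (\<tau> * \<tau>') + (cosh t)\<^sup>2 * (\<zeta> \<bullet> \<zeta>') + \<xi> \<bullet> \<xi>')"

definition nariai_atlas ::
  "'r::euclidean_space set \<Rightarrow> (real \<times> 'r \<times> (real^3), 4) chart set" where
  "nariai_atlas C = submanifold_atlas (nariai_space C)"

definition nariai_metric :: "real \<Rightarrow> (real \<times> 'r::euclidean_space \<times> (real^3), 4) tensor2" where
  "nariai_metric \<Lambda> = induced_tensor (nariai_form \<Lambda>)"

end

theory Submission
  imports Defs
begin

text \<open>The two-dimensional de Sitter space is the unit hyperboloid in Minkowski space, so Nariai is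
  locally a product of two unit hyperquadrics, and by the Gauss equation its Riemann tensor is
  \<open>h\<^sub>1 \<and> h\<^sub>1 + h\<^sub>2 \<and> h\<^sub>2\<close>, where \<open>h\<^sub>1\<close>, \<open>h\<^sub>2\<close> are the pullbacks of the metrics of the two factors.
  In a chart at a boundary point the metric is \<open>\<Omega>\<^sup>-\<^sup>2 G\<close> with \<open>\<Omega>\<close> and \<open>G\<close> smooth up to the boundary. There
  \<open>\<Omega>\<^sup>4\<close> times the Riemann tensor tends to \<open>k G\<^sub>0 \<and> G\<^sub>0\<close> for a constant \<open>k\<close>, as for every conformally
  compact metric. This is incompatible with the product structure: take a unit vector \<open>u\<close> tangent to
  the first factor and orthonormal vectors \<open>v\<close>, \<open>v'\<close> tangent to the second (all with respect to the
  Euclidean norm of the chart, so that limits exist). In the limit the curvature on \<open>u, v\<close> and \<open>u, v'\<close>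
  vanishes, while on \<open>v, v'\<close> it is that of \<open>G\<^sub>0 \<and> G\<^sub>0\<close>. Hence \<open>k = 1\<close>, and both \<open>v\<close> and \<open>v'\<close> are multiples
  of \<open>u\<close>.\<close>

section \<open>Differentiability of finite order\<close>

text \<open>The obstacle is that the product splitting need not extend to the boundary: only the sum
  of the two parts, multiplied by \<open>\<Omega>\<^sup>2\<close>, has a limit, and each part may
  degenerate on its own. Directions tangent to the factors therefore converge only along a
  subsequence, and nothing is known about their lengths with respect to the limit metric, in which
  they may be null. For this reason the contradiction uses only linear dependence, detected by the
  nondegenerate form \<open>G0\<close>. Two directions of the second factor are required, because a
  single limit \<open>v0\<close> could coincide with that of the first factor. The weight
  \<open>\<Omega>\<^sup>4\<close> is forced: the wedge square of the metric scales with the square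
  of the conformal factor \<open>\<Omega>\<^sup>-\<^sup>2\<close>. Realising the factors in flat
  spaces turns curvature into algebra in second derivatives, so no connection has to be constructed.
  Everything happens in one chart near one boundary point, so a global difference such as circle
  versus line cannot matter.\<close>

abbreviation ddir :: "('a::euclidean_space \<Rightarrow> 'b::euclidean_space) \<Rightarrow> 'a \<Rightarrow> 'a \<Rightarrow> 'b" where
  "ddir f v \<equiv> \<lambda>x. frechet_derivative f (at x) v"

lemma ddir_eqI: "(f has_derivative f') (at x) \<Longrightarrow> ddir f v x = f' v"
  by (metis frechet_derivative_at)

lemma Ck_on_imp_continuous_on: "Ck_on k S f \<Longrightarrow> continuous_on S f"
proof (cases k)
  case (Suc m)
  then show "Ck_on k S f \<Longrightarrow> continuous_on S f"
    by (simp add: differentiable_at_imp_differentiable_on differentiable_imp_continuous_on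
        differentiable_on_def differentiable_at_withinI)
qed simp

lemma Ck_on_Suc_imp: "Ck_on (Suc k) S f \<Longrightarrow> Ck_on k S f"
proof (induction k arbitrary: f)
  case 0
  then show ?case using Ck_on_imp_continuous_on by (metis Ck_on.simps(1))
next
  case (Suc k)
  then show ?case by (metis Ck_on.simps(2))
qed

lemma Ck_on_le: "Ck_on k S f \<Longrightarrow> m \<le> k \<Longrightarrow> Ck_on m S f"
proof (induction k)
  case (Suc k)
  then show ?case by (metis Ck_on_Suc_imp le_Suc_eq)
qed simp

lemma Ck_on_subset: "Ck_on k S f \<Longrightarrow> T \<subseteq> S \<Longrightarrow> Ck_on k T f"
  by (induction k arbitrary: f) (auto intro: continuous_on_subset)

lemma frechet_derivative_cong_open:
  assumes "open S" "x \<in> S" "\<And>y. y \<in> S \<Longrightarrow> f y = g y"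
  shows "frechet_derivative f (at x) = frechet_derivative g (at x)"
proof -
  have "(f has_derivative D) (at x) \<longleftrightarrow> (g has_derivative D) (at x)" for D
    using assms has_derivative_transform_within_open[of f D x UNIV S g]
      has_derivative_transform_within_open[of g D x UNIV S f] by auto
  then show ?thesis by (simp add: frechet_derivative_def)
qed

lemma Ck_on_cong:
  assumes "open S" "\<And>y. y \<in> S \<Longrightarrow> f y = g y" "Ck_on k S f"
  shows "Ck_on k S g"
  using assms(2,3)
proof (induction k arbitrary: f g)
  case 0
  then show ?case by (metis Ck_on.simps(1) continuous_on_cong)
next
  case (Suc k)
  have "g differentiable at x" if "x \<in> S" for x
    using Suc.prems that assms(1)
    by (meson Ck_on.simps(2) differentiable_def has_derivative_transform_within_open)
  moreover have "Ck_on k S (ddir g v)" for v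
  proof (rule Suc.IH)
    show "Ck_on k S (ddir f v)" using Suc.prems by simp
    show "ddir f v y = ddir g v y" if "y \<in> S" for y
      using frechet_derivative_cong_open[OF assms(1) that Suc.prems(1)] by simp
  qed
  ultimately show ?case by simp
qed

lemma Ck_on_local:
  assumes "\<And>x. x \<in> S \<Longrightarrow> \<exists>U. open U \<and> x \<in> U \<and> Ck_on k U f"
  shows "Ck_on k S f"
  using assms
proof (induction k arbitrary: f)
  case 0
  have "continuous (at x) f" if "x \<in> S" for x
    using 0[OF that] by (auto simp: continuous_on_eq_continuous_at)
  then show ?case by (simp add: continuous_at_imp_continuous_on)
next
  case (Suc k)
  have "f differentiable at x" if "x \<in> S" for x
    using Suc.prems[OF that] by auto
  moreover have "Ck_on k S (ddir f v)" for v
    by (rule Suc.IH) (use Suc.prems in fastforce)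
  ultimately show ?case by simp
qed

lemma Ck_on_SucI:
  assumes "open S"
    and "\<And>x. x \<in> S \<Longrightarrow> (f has_derivative (\<lambda>v. f' v x)) (at x)"
    and "\<And>v. Ck_on k S (f' v)"
  shows "Ck_on (Suc k) S f"
proof -
  have "Ck_on k S (ddir f v)" for v
    by (rule Ck_on_cong[OF assms(1) _ assms(3)[of v]]) (metis assms(2) ddir_eqI)
  then show ?thesis using assms(2) by (auto simp: differentiable_def)
qed

lemma Ck_on_SucD:
  assumes "Ck_on (Suc k) S f" "x \<in> S"
  shows "(f has_derivative (\<lambda>v. ddir f v x)) (at x)"
  using assms by (simp add: frechet_derivative_works)

lemma Ck_on_const: "open S \<Longrightarrow> Ck_on k S (\<lambda>x. c)"
proof (induction k arbitrary: c)
  case (Suc k)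
  then show ?case by (intro Ck_on_SucI[where f'="\<lambda>v x. 0"]) auto
qed simp

lemma Ck_on_linear:
  assumes "open S" "linear f"
  shows "Ck_on k S f"
proof (cases k)
  case 0
  then show ?thesis using assms by (simp add: linear_continuous_on linear_linear)
next
  case (Suc m)
  have "Ck_on (Suc m) S f"
    by (intro Ck_on_SucI[where f'="\<lambda>v x. f v"] Ck_on_const assms(1))
       (use assms bounded_linear_imp_has_derivative linear_linear in blast)
  then show ?thesis using Suc by simp
qed

lemma Ck_on_add:
  assumes "open S" "Ck_on k S f" "Ck_on k S g"
  shows "Ck_on k S (\<lambda>x. f x + g x)"
  using assms(2,3)
proof (induction k arbitrary: f g)
  case 0
  then show ?case by (simp add: continuous_on_add)
next
  case (Suc k)
  show ?case
  proof (rule Ck_on_SucI[where f'="\<lambda>v x. ddir f v x + ddir g v x"])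
    show "((\<lambda>x. f x + g x) has_derivative (\<lambda>v. ddir f v x + ddir g v x)) (at x)" if "x \<in> S" for x
      using Suc.prems that by (intro has_derivative_add Ck_on_SucD)
  qed (use assms(1) Suc in auto)
qed

lemma Ck_on_bilinear:
  assumes "open S" "bounded_bilinear prd" "Ck_on k S f" "Ck_on k S g"
  shows "Ck_on k S (\<lambda>x. prd (f x) (g x))"
  using assms(3,4)
proof (induction k arbitrary: f g)
  case 0
  then show ?case using assms(2) by (simp add: bounded_bilinear.continuous_on)
next
  case (Suc k)
  show ?case
  proof (rule Ck_on_SucI[where f'="\<lambda>v x. prd (f x) (ddir g v x) + prd (ddir f v x) (g x)"])
    show "((\<lambda>x. prd (f x) (g x)) has_derivative
        (\<lambda>v. prd (f x) (ddir g v x) + prd (ddir f v x) (g x))) (at x)" if "x \<in> S" for x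
      using Suc.prems that by (intro bounded_bilinear.FDERIV[OF assms(2)] Ck_on_SucD)
    show "Ck_on k S (\<lambda>x. prd (f x) (ddir g v x) + prd (ddir f v x) (g x))" for v
      using Suc.prems by (intro Ck_on_add Suc.IH assms(1)) (auto dest: Ck_on_Suc_imp simp del: Ck_on.simps, auto)
  qed (use assms(1) in auto)
qed

lemmas Ck_on_mult = Ck_on_bilinear[OF _ bounded_bilinear_mult]
lemmas Ck_on_scaleR = Ck_on_bilinear[OF _ bounded_bilinear_scaleR]
lemmas Ck_on_inner = Ck_on_bilinear[OF _ bounded_bilinear_inner]

lemma Ck_on_sum:
  assumes "open S" "finite I" "\<And>i. i \<in> I \<Longrightarrow> Ck_on k S (f i)"
  shows "Ck_on k S (\<lambda>x. \<Sum>i\<in>I. f i x)"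
  using assms(2,3)
  by (induction I rule: finite_induct) (auto intro: Ck_on_const Ck_on_add assms(1))

text \<open>By the chain rule the derivative of the composition is a derivative of \<open>g\<close>
  in the moving direction \<open>ddir f v x\<close>, whereas \<open>Ck_on\<close> speaks of fixed
  directions only. Expanding the moving direction in the basis leaves fixed directions with
  differentiable coefficients.\<close>

lemma Ck_on_compose:
  assumes "open S" "open T" "f ` S \<subseteq> T" "Ck_on k T g" "Ck_on k S f"
  shows "Ck_on k S (\<lambda>x. g (f x))"
  using assms(4,5)
proof (induction k arbitrary: g)
  case 0
  then show ?case using continuous_on_compose2[OF _ _ assms(3), of g] by simp
next
  case (Suc k)
  have fS: "Ck_on k S f" using Suc.prems Ck_on_Suc_imp by blast
  show ?case
  proof (rule Ck_on_SucI[where f'="\<lambda>v x. \<Sum>b\<in>Basis. (ddir f v x \<bullet> b) *\<^sub>R ddir g b (f x)"])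
    fix x assume x: "x \<in> S"
    have "(g has_derivative (\<lambda>v. ddir g v (f x))) (at (f x))"
      using assms(3) x by (intro Ck_on_SucD[OF Suc.prems(1)]) auto
    from diff_chain_at[OF Ck_on_SucD[OF Suc.prems(2) x] this]
    have 1: "((\<lambda>x. g (f x)) has_derivative (\<lambda>v. ddir g (ddir f v x) (f x))) (at x)"
      by (simp add: o_def)
    have lin: "linear (\<lambda>v. ddir g v (f x))"
      using \<open>(g has_derivative (\<lambda>v. ddir g v (f x))) (at (f x))\<close> has_derivative_linear by blast
    have "ddir g w (f x) = (\<Sum>b\<in>Basis. (w \<bullet> b) *\<^sub>R ddir g b (f x))" for w
      using linear_sum[OF lin, of "\<lambda>b. (w \<bullet> b) *\<^sub>R b" Basis]
      by (simp add: euclidean_representation linear_scale[OF lin])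
    from this[of "ddir f _ x"] show "((\<lambda>x. g (f x)) has_derivative
        (\<lambda>v. \<Sum>b\<in>Basis. (ddir f v x \<bullet> b) *\<^sub>R ddir g b (f x))) (at x)"
      by (rule has_derivative_eq_rhs[OF 1 ext])
  next
    show "Ck_on k S (\<lambda>x. \<Sum>b\<in>Basis. (ddir f v x \<bullet> b) *\<^sub>R ddir g b (f x))" for v
      using Suc.prems
      by (intro Ck_on_sum Ck_on_scaleR Ck_on_inner Ck_on_const assms(1) Suc.IH fS) auto
  qed (use assms(1) in auto)
qed

text \<open>Meant for functions whose derivative is a polynomial in the function itself or in a
  partner function: \<open>inverse\<close>, the pair \<open>sin\<close>, \<open>cos\<close> and the
  pair \<open>sinh\<close>, \<open>cosh\<close>. Induction on the order then closes.\<close>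

lemma Ck_on_real_fun:
  fixes f :: "real \<Rightarrow> real"
  assumes "open S" "\<And>x. x \<in> S \<Longrightarrow> (f has_field_derivative f' x) (at x)" "Ck_on k S f'"
  shows "Ck_on (Suc k) S f"
proof (rule Ck_on_SucI[where f'="\<lambda>v x. f' x * v"])
  show "(f has_derivative (\<lambda>v. f' x * v)) (at x)" if "x \<in> S" for x
    using assms(2)[OF that] by (simp add: has_field_derivative_def)
  show "Ck_on k S (\<lambda>x. f' x * v)" for v
    by (intro Ck_on_mult Ck_on_const assms)
qed (rule assms)

lemma Ck_on_inverse: "Ck_on k (- {0::real}) inverse"
proof (induction k)
  case (Suc k)
  show ?case
  proof (rule Ck_on_real_fun[where f'="\<lambda>x. - 1 * (inverse x * inverse x)"])
    show "Ck_on k (- {0::real}) (\<lambda>x. - 1 * (inverse x * inverse x))"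
      by (intro Ck_on_mult Ck_on_const Suc) auto
  qed (auto intro!: derivative_eq_intros)
qed (auto intro: continuous_intros)

lemma Ck_on_divide:
  fixes f g :: "'a::euclidean_space \<Rightarrow> real"
  assumes "open S" "\<And>x. x \<in> S \<Longrightarrow> g x \<noteq> 0" "Ck_on k S f" "Ck_on k S g"
  shows "Ck_on k S (\<lambda>x. f x / g x)"
  unfolding divide_inverse
  by (intro Ck_on_mult assms Ck_on_compose[of S "-{0}" g, OF _ _ _ Ck_on_inverse]) (use assms(2) in auto)

lemma Ck_on_sin_cos: "Ck_on k UNIV (sin :: real \<Rightarrow> real) \<and> Ck_on k UNIV (cos :: real \<Rightarrow> real)"
proof (induction k)
  case (Suc k)
  then have "Ck_on k UNIV (\<lambda>x. - 1 * sin x :: real)"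
    by (intro Ck_on_mult Ck_on_const) auto
  with Suc show ?case
    by (auto intro!: Ck_on_real_fun[where f=sin and f'=cos]
        Ck_on_real_fun[where f=cos and f'="\<lambda>x. - 1 * sin x"] derivative_eq_intros simp del: Ck_on.simps)
qed (auto intro: continuous_intros)

lemma Ck_on_sinh_cosh: "Ck_on k UNIV (sinh :: real \<Rightarrow> real) \<and> Ck_on k UNIV (cosh :: real \<Rightarrow> real)"
proof (induction k)
  case (Suc k)
  then show ?case
    by (auto intro!: Ck_on_real_fun[where f=sinh and f'=cosh]
        Ck_on_real_fun[where f=cosh and f'=sinh] derivative_eq_intros simp del: Ck_on.simps)
qed (auto intro!: continuous_intros)

lemma Ck_on_linear_compose:
  assumes "open S" "linear L" "Ck_on k S f"
  shows "Ck_on k S (\<lambda>x. L (f x))"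
  by (rule Ck_on_compose[OF assms(1) open_UNIV _ Ck_on_linear[OF open_UNIV assms(2)] assms(3)]) auto

lemma Ck_on_Pair:
  assumes "open S" "Ck_on k S f" "Ck_on k S g"
  shows "Ck_on k S (\<lambda>x. (f x, g x))"
proof -
  have "linear (\<lambda>y. (y, 0))" "linear (\<lambda>y. (0, y))" by (auto intro!: linearI)
  then have "Ck_on k S (\<lambda>x. (f x, 0) + (0, g x))"
    using assms by (intro Ck_on_add Ck_on_linear_compose[where L="\<lambda>y. (y, 0)"]
        Ck_on_linear_compose[where L="\<lambda>y. (0, y)"])
  then show ?thesis by simp
qed

lemma linear_ddir:
  assumes "Ck_on (Suc k) S f" "x \<in> S"
  shows "linear (\<lambda>v. ddir f v x)"
  using Ck_on_SucD[OF assms] has_derivative_linear by blast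

section \<open>Symmetry of second derivatives\<close>

lemma real_derivative_along_line:
  assumes "(g has_derivative g') (at (p + r *\<^sub>R v))"
  shows "((\<lambda>r. g (p + r *\<^sub>R v)) has_real_derivative g' v) (at r)"
proof -
  have "((\<lambda>r. p + r *\<^sub>R v) has_derivative (\<lambda>r. r *\<^sub>R v)) (at r)"
    by (auto intro!: derivative_eq_intros)
  from diff_chain_at[OF this assms] have "((\<lambda>r. g (p + r *\<^sub>R v)) has_derivative (\<lambda>r. g' (r *\<^sub>R v))) (at r)"
    by (simp add: o_def)
  moreover have "g' (r *\<^sub>R v) = g' v * r" for r
    using linear_scale[OF has_derivative_linear[OF assms], of r v] by simp
  ultimately show ?thesis by (simp add: has_field_derivative_def)
qed

text \<open>Two applications of the mean value theorem: to the difference of \<open>f\<close> on two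
  parallel segments in direction \<open>v\<close>, then to \<open>ddir f v\<close> along a segment
  in direction \<open>w\<close>.\<close>

lemma second_difference_mean_value:
  fixes f :: "'a::euclidean_space \<Rightarrow> real"
  assumes f: "Ck_on 2 S f" and ball: "ball x e \<subseteq> S" and s: "0 < s" "s * (norm v + norm w) < e"
  shows "\<exists>p. dist p x \<le> s * (norm v + norm w) \<and>
    f (x + s *\<^sub>R v + s *\<^sub>R w) - f (x + s *\<^sub>R v) - f (x + s *\<^sub>R w) + f x
      = s\<^sup>2 * ddir (ddir f v) w p"
proof -
  have bound: "norm (r *\<^sub>R v + t *\<^sub>R w) \<le> s * (norm v + norm w)"
    if "0 \<le> r" "r \<le> s" "0 \<le> t" "t \<le> s" for r t
  proof -
    have "norm (r *\<^sub>R v + t *\<^sub>R w) \<le> norm (r *\<^sub>R v) + norm (t *\<^sub>R w)" by (rule norm_triangle_ineq)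
    also have "\<dots> \<le> s * norm v + s * norm w"
      using that by (intro add_mono) (auto intro: mult_right_mono)
    finally show ?thesis by (simp add: distrib_left)
  qed
  have inS: "x + r *\<^sub>R v + t *\<^sub>R w \<in> S" if "0 \<le> r" "r \<le> s" "0 \<le> t" "t \<le> s" for r t
  proof -
    have "dist x (x + (r *\<^sub>R v + t *\<^sub>R w)) < e"
      using bound[OF that] s(2) by (subst dist_commute) (simp add: dist_norm)
    then show ?thesis using ball by (auto simp: add.assoc)
  qed
  have f1: "Ck_on (Suc 0) S (ddir f v)" and f2: "Ck_on (Suc (Suc 0)) S f"
    using f by (simp_all add: numeral_2_eq_2)
  have d1: "((\<lambda>r. f (x + t *\<^sub>R w + r *\<^sub>R v)) has_real_derivative ddir f v (x + t *\<^sub>R w + r *\<^sub>R v)) (at r)"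
    if "0 \<le> r" "r \<le> s" "0 \<le> t" "t \<le> s" for r t
    using inS[OF that] by (intro real_derivative_along_line Ck_on_SucD[OF f2]) (simp add: algebra_simps)
  have "((\<lambda>r. f (x + s *\<^sub>R w + r *\<^sub>R v) - f (x + r *\<^sub>R v)) has_real_derivative
      ddir f v (x + s *\<^sub>R w + r *\<^sub>R v) - ddir f v (x + r *\<^sub>R v)) (at r)" if "0 \<le> r" "r \<le> s" for r
    using DERIV_diff[OF d1[of r s] d1[of r 0]] that s(1) by simp
  then have "\<exists>r>0. r < s \<and> (f (x + s *\<^sub>R w + s *\<^sub>R v) - f (x + s *\<^sub>R v)) - (f (x + s *\<^sub>R w + 0 *\<^sub>R v) - f (x + 0 *\<^sub>R v))
      = (s - 0) * (ddir f v (x + s *\<^sub>R w + r *\<^sub>R v) - ddir f v (x + r *\<^sub>R v))"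
    by (rule MVT2[OF s(1)])
  then obtain r where r: "0 < r" "r < s" "f (x + s *\<^sub>R v + s *\<^sub>R w) - f (x + s *\<^sub>R v) - f (x + s *\<^sub>R w) + f x
      = s * (ddir f v (x + s *\<^sub>R w + r *\<^sub>R v) - ddir f v (x + r *\<^sub>R v))"
    by (auto simp: algebra_simps)
  have d2: "((\<lambda>t. ddir f v (x + r *\<^sub>R v + t *\<^sub>R w)) has_real_derivative
      ddir (ddir f v) w (x + r *\<^sub>R v + t *\<^sub>R w)) (at t)" if "0 \<le> t" "t \<le> s" for t
    using inS[of r t] that r by (intro real_derivative_along_line Ck_on_SucD[OF f1]) simp
  have "\<exists>t>0. t < s \<and> ddir f v (x + r *\<^sub>R v + s *\<^sub>R w) - ddir f v (x + r *\<^sub>R v + 0 *\<^sub>R w)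
      = (s - 0) * ddir (ddir f v) w (x + r *\<^sub>R v + t *\<^sub>R w)"
    by (rule MVT2[OF s(1) d2])
  then obtain t where t: "0 < t" "t < s" "ddir f v (x + s *\<^sub>R w + r *\<^sub>R v) - ddir f v (x + r *\<^sub>R v)
      = s * ddir (ddir f v) w (x + r *\<^sub>R v + t *\<^sub>R w)"
    by (auto simp: algebra_simps)
  show ?thesis
    using r t bound[of r t] by (intro exI[of _ "x + r *\<^sub>R v + t *\<^sub>R w"])
      (auto simp: dist_norm power2_eq_square add.assoc)
qed

text \<open>The second difference is symmetric in \<open>v\<close> and \<open>w\<close>, so both
  mixed derivatives attain the same value at points arbitrarily close to \<open>x\<close>;
  continuity does the rest.\<close>

lemma ddir_commute_real:
  fixes f :: "'a::euclidean_space \<Rightarrow> real"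
  assumes "open S" "Ck_on 2 S f" "x \<in> S"
  shows "ddir (ddir f v) w x = ddir (ddir f w) v x"
proof (rule ccontr)
  let ?A = "ddir (ddir f v) w" and ?B = "ddir (ddir f w) v"
  assume neq: "?A x \<noteq> ?B x"
  define \<epsilon> where "\<epsilon> = \<bar>?A x - ?B x\<bar> / 2"
  have \<epsilon>: "\<epsilon> > 0" using neq by (simp add: \<epsilon>_def)
  obtain e where e: "e > 0" "ball x e \<subseteq> S" using assms openE by blast
  have cont: "isCont ?A x" "isCont ?B x"
    using assms by (auto simp: numeral_2_eq_2 continuous_on_eq_continuous_at)
  obtain d1 where d1: "d1 > 0" "\<And>p. dist p x < d1 \<Longrightarrow> dist (?A p) (?A x) < \<epsilon>"
    using cont(1)[unfolded continuous_at_eps_delta, rule_format, OF \<epsilon>] by blast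
  obtain d2 where d2: "d2 > 0" "\<And>p. dist p x < d2 \<Longrightarrow> dist (?B p) (?B x) < \<epsilon>"
    using cont(2)[unfolded continuous_at_eps_delta, rule_format, OF \<epsilon>] by blast
  \<comment> \<open>The summand 1 keeps the denominator positive when \<open>v\<close> and
    \<open>w\<close> both vanish and makes the later bound strict.\<close>
  define s where "s = min e (min d1 d2) / (norm v + norm w + 1)"
  have m: "0 < min e (min d1 d2)" using d1 d2 e by simp
  then have s0: "s > 0" by (simp add: s_def add_nonneg_pos)
  have "s * (norm v + norm w) < s * (norm v + norm w + 1)" using s0 by simp
  also have "\<dots> = min e (min d1 d2)" by (simp add: s_def add_nonneg_eq_0_iff)
  finally have s: "s * (norm v + norm w) < min e (min d1 d2)" .
  obtain p where p: "dist p x \<le> s * (norm v + norm w)"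
      "f (x + s *\<^sub>R v + s *\<^sub>R w) - f (x + s *\<^sub>R v) - f (x + s *\<^sub>R w) + f x = s\<^sup>2 * ?A p"
    using second_difference_mean_value[OF assms(2) e(2) s0, of v w] s by auto
  obtain q where q: "dist q x \<le> s * (norm v + norm w)"
      "f (x + s *\<^sub>R w + s *\<^sub>R v) - f (x + s *\<^sub>R w) - f (x + s *\<^sub>R v) + f x = s\<^sup>2 * ?B q"
    using second_difference_mean_value[OF assms(2) e(2) s0, of w v] s by (auto simp: add.commute)
  have "s\<^sup>2 * ?A p = s\<^sup>2 * ?B q" using p(2) q(2) by (simp add: algebra_simps)
  then have "?A p = ?B q" using s0 by simp
  moreover have "dist p x < d1" "dist q x < d2" using p(1) q(1) s by simp_all
  ultimately show False
    using d1(2)[of p] d2(2)[of q] unfolding dist_real_def \<epsilon>_def by (simp add: abs_if split: if_splits)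
qed

lemma ddir_linear_compose:
  assumes "linear L" "f differentiable at x"
  shows "ddir (\<lambda>x. L (f x)) v x = L (ddir f v x)"
  using assms by (intro ddir_eqI)
    (auto intro: has_derivative_compose[where g=L, OF _ linear_imp_has_derivative]
      simp: frechet_derivative_works)

lemma ddir_commute:
  fixes f :: "'a::euclidean_space \<Rightarrow> 'b::euclidean_space"
  assumes "open S" "Ck_on 2 S f" "x \<in> S"
  shows "ddir (ddir f v) w x = ddir (ddir f w) v x"
proof (rule euclidean_eqI)
  fix b :: 'b assume "b \<in> Basis"
  have lin: "linear (\<lambda>y. y \<bullet> b)" by (simp add: bounded_linear.linear bounded_linear_inner_left)
  have comp: "ddir (ddir (\<lambda>x. f x \<bullet> b) v) w x = ddir (ddir f v) w x \<bullet> b" for v w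
  proof -
    have "ddir (ddir (\<lambda>x. f x \<bullet> b) v) w x = ddir (\<lambda>x. ddir f v x \<bullet> b) w x"
      using assms by (subst frechet_derivative_cong_open[OF assms(1,3), of _ "\<lambda>x. ddir f v x \<bullet> b"])
        (auto simp: numeral_2_eq_2 intro: ddir_linear_compose[OF lin])
    also have "\<dots> = ddir (ddir f v) w x \<bullet> b"
      using assms by (intro ddir_linear_compose[OF lin]) (auto simp: numeral_2_eq_2)
    finally show ?thesis .
  qed
  have "Ck_on 2 S (\<lambda>x. f x \<bullet> b)" by (rule Ck_on_linear_compose[OF assms(1) lin assms(2)])
  from ddir_commute_real[OF assms(1) this assms(3)]
  show "ddir (ddir f v) w x \<bullet> b = ddir (ddir f w) v x \<bullet> b" by (simp add: comp)
qed

section \<open>The Gauss equation for products of unit hyperquadrics\<close>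

text \<open>\<open>curvature2\<close> is the part of the lowered Riemann tensor that is linear in the second derivatives of
  the metric; the arguments \<open>a, b, c, d\<close> are constant vector fields.\<close>

definition christoffel1 :: "('a::euclidean_space \<Rightarrow> 'a \<Rightarrow> 'a \<Rightarrow> real) \<Rightarrow> 'a \<Rightarrow> 'a \<Rightarrow> 'a \<Rightarrow> 'a \<Rightarrow> real" where
  "christoffel1 H a b m x = (ddir (H b m) a x + ddir (H a m) b x - ddir (H a b) m x) / 2"

definition curvature2 :: "('a::euclidean_space \<Rightarrow> 'a \<Rightarrow> 'a \<Rightarrow> real) \<Rightarrow> 'a \<Rightarrow> 'a \<Rightarrow> 'a \<Rightarrow> 'a \<Rightarrow> 'a \<Rightarrow> real" where
  "curvature2 H a b c d x = (ddir (ddir (H a d) c) b x + ddir (ddir (H b c) d) a x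
     - ddir (ddir (H b d) c) a x - ddir (ddir (H a c) d) b x) / 2"

abbreviation pullback_form ::
  "('y \<Rightarrow> 'y \<Rightarrow> real) \<Rightarrow> ('a::euclidean_space \<Rightarrow> 'y::euclidean_space) \<Rightarrow> 'a \<Rightarrow> 'a \<Rightarrow> 'a \<Rightarrow> real" where
  "pullback_form \<beta> Y u v \<equiv> \<lambda>x. \<beta> (ddir Y u x) (ddir Y v x)"

lemma ddir_add:
  assumes "open W" "x \<in> W" "\<And>y. y \<in> W \<Longrightarrow> f y = g y + h y"
    "g differentiable at x" "h differentiable at x"
  shows "ddir f v x = ddir g v x + ddir h v x"
proof -
  have "ddir (\<lambda>y. g y + h y) v x = ddir g v x + ddir h v x"
    using assms(4,5) by (intro ddir_eqI has_derivative_add) (simp_all add: frechet_derivative_works)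
  then show ?thesis by (simp add: frechet_derivative_cong_open[OF assms(1,2,3)])
qed

text \<open>Since \<beta> may be indefinite, de Sitter space and the round sphere are both covered.
  In the application the domain has dimension 4 and each quadric dimension 2, so the derivative of
  \<open>Y\<close> has a kernel; only the pair of the two maps is an immersion. Order 3 is required
  because the curvature takes two derivatives of a form that already contains first derivatives of
  \<open>Y\<close>.\<close>

locale unit_immersion =
  fixes W :: "'a::euclidean_space set" and \<beta> :: "'y::euclidean_space \<Rightarrow> 'y \<Rightarrow> real" and Y :: "'a \<Rightarrow> 'y"
  assumes op: "open W" and C3: "Ck_on 3 W Y" and bil: "bounded_bilinear \<beta>"
    and sym: "\<beta> y z = \<beta> z y" and unit: "x \<in> W \<Longrightarrow> \<beta> (Y x) (Y x) = 1"
begin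

lemma Ck_Y: "Ck_on (Suc (Suc 0)) W Y" "Ck_on (Suc 0) W Y"
  and Ck_dY: "Ck_on (Suc (Suc 0)) W (ddir Y u)" "Ck_on (Suc 0) W (ddir Y u)"
  and Ck_ddY: "Ck_on (Suc 0) W (ddir (ddir Y u) v)"
proof -
  show "Ck_on (Suc (Suc 0)) W Y" "Ck_on (Suc 0) W Y"
    by (rule Ck_on_le[OF C3], simp)+
  show *: "Ck_on (Suc (Suc 0)) W (ddir Y u)" for u
    using C3 unfolding numeral_3_eq_3 by (subst (asm) Ck_on.simps(2)) blast
  show "Ck_on (Suc 0) W (ddir Y u)"
    by (rule Ck_on_le[OF *]) simp
  show "Ck_on (Suc 0) W (ddir (ddir Y u) v)"
    using * by (subst (asm) Ck_on.simps(2)) blast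
qed

lemma ddir_product:
  assumes "x \<in> W" "Ck_on (Suc 0) W f" "Ck_on (Suc 0) W g"
  shows "ddir (\<lambda>x. \<beta> (f x) (g x)) v x = \<beta> (f x) (ddir g v x) + \<beta> (ddir f v x) (g x)"
  using assms by (intro ddir_eqI bounded_bilinear.FDERIV[OF bil] Ck_on_SucD)

lemma differentiable_product:
  assumes "x \<in> W" "Ck_on (Suc 0) W f" "Ck_on (Suc 0) W g"
  shows "(\<lambda>x. \<beta> (f x) (g x)) differentiable at x"
  using bounded_bilinear.FDERIV[OF bil Ck_on_SucD[OF assms(2,1)] Ck_on_SucD[OF assms(3,1)]]
  by (rule differentiableI)

lemma tangent_orthogonal:
  assumes x: "x \<in> W" shows "\<beta> (Y x) (ddir Y u x) = 0"
proof -
  have "ddir (\<lambda>x. \<beta> (Y x) (Y x)) u x = 0"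
    by (subst frechet_derivative_cong_open[OF op x, of _ "\<lambda>_. 1"]) (auto simp: unit)
  then show ?thesis using ddir_product[OF x Ck_Y(2) Ck_Y(2), of u] sym[of "ddir Y u x"] by simp
qed

text \<open>Derivative of the orthogonality of position and tangent vectors. It identifies the
  second fundamental form with respect to the normal \<open>Y\<close> as minus the pulled back form,
  which is where the constant curvature of the quadric comes from.\<close>

lemma normal_component:
  assumes x: "x \<in> W" shows "\<beta> (Y x) (ddir (ddir Y u) v x) = - \<beta> (ddir Y u x) (ddir Y v x)"
proof -
  have "ddir (\<lambda>x. \<beta> (Y x) (ddir Y u x)) v x = 0"
    by (subst frechet_derivative_cong_open[OF op x, of _ "\<lambda>_. 0"]) (auto simp: tangent_orthogonal)
  then show ?thesis using ddir_product[OF x Ck_Y(2) Ck_dY(2), of u v] sym[of "ddir Y u x"] by simp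
qed

lemma second_commute: "x \<in> W \<Longrightarrow> ddir (ddir Y u) v x = ddir (ddir Y v) u x"
  using ddir_commute[OF op] Ck_Y by (simp add: numeral_2_eq_2)

lemma third_commute:
  assumes "x \<in> W"
  shows "ddir (ddir (ddir Y u) v) w x = ddir (ddir (ddir Y v) u) w x"
    and "ddir (ddir (ddir Y u) v) w x = ddir (ddir (ddir Y u) w) v x"
proof -
  show "ddir (ddir (ddir Y u) v) w x = ddir (ddir (ddir Y v) u) w x"
    by (subst frechet_derivative_cong_open[OF op assms second_commute]) simp_all
  show "ddir (ddir (ddir Y u) v) w x = ddir (ddir (ddir Y u) w) v x"
    using ddir_commute[OF op _ assms, of "ddir Y u"] Ck_dY by (simp add: numeral_2_eq_2)
qed

lemma pullback_ddir:
  assumes x: "x \<in> W"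
  shows "ddir (pullback_form \<beta> Y u v) c x
    = \<beta> (ddir Y u x) (ddir (ddir Y v) c x) + \<beta> (ddir (ddir Y u) c x) (ddir Y v x)"
  by (rule ddir_product[OF x Ck_dY(2) Ck_dY(2)])

lemma pullback_ddir2:
  assumes x: "x \<in> W"
  shows "ddir (ddir (pullback_form \<beta> Y u v) c) d x
    = \<beta> (ddir Y u x) (ddir (ddir (ddir Y v) c) d x) + \<beta> (ddir (ddir Y u) d x) (ddir (ddir Y v) c x)
    + (\<beta> (ddir (ddir Y u) c x) (ddir (ddir Y v) d x) + \<beta> (ddir (ddir (ddir Y u) c) d x) (ddir Y v x))"
  by (subst ddir_add[OF op x pullback_ddir])
     (use x in \<open>auto intro!: differentiable_product Ck_dY Ck_ddY simp: ddir_product[OF x Ck_dY(2) Ck_ddY] ddir_product[OF x Ck_ddY Ck_dY(2)] simp del: Ck_on.simps\<close>)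

lemma pullback_Ck: "Ck_on (Suc (Suc 0)) W (pullback_form \<beta> Y u v)"
  by (intro Ck_on_bilinear[OF op bil] Ck_dY)

text \<open>As \<beta> has constant coefficients, each derivative of the form splits into two
  products; by symmetry of second derivatives all but one pair cancel.\<close>

lemma pullback_christoffel1:
  assumes x: "x \<in> W"
  shows "christoffel1 (pullback_form \<beta> Y) a b m x = \<beta> (ddir (ddir Y a) b x) (ddir Y m x)"
  unfolding christoffel1_def pullback_ddir[OF x]
  using second_commute[OF x, of a b] second_commute[OF x, of a m] second_commute[OF x, of b m]
  by (simp add: sym[of "ddir Y _ x"])

text \<open>All third derivatives of \<open>Y\<close> cancel by symmetry, leaving products of second
  derivatives.\<close>

lemma pullback_curvature2:
  assumes x: "x \<in> W"
  shows "curvature2 (pullback_form \<beta> Y) a b c d x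
    = \<beta> (ddir (ddir Y a) c x) (ddir (ddir Y b) d x) - \<beta> (ddir (ddir Y b) c x) (ddir (ddir Y a) d x)"
proof -
  note c2 = second_commute[OF x] and c3 = third_commute[OF x]
  \<comment> \<open>Mixed derivatives are brought to a normal order so that the cancellation becomes
    syntactic.\<close>
  have "ddir (ddir (ddir Y d) c) b x = ddir (ddir (ddir Y b) c) d x"
    "ddir (ddir (ddir Y c) d) b x = ddir (ddir (ddir Y b) c) d x"
    "ddir (ddir (ddir Y d) c) a x = ddir (ddir (ddir Y a) c) d x"
    "ddir (ddir (ddir Y c) d) a x = ddir (ddir (ddir Y a) c) d x"
    "ddir (ddir (ddir Y a) c) b x = ddir (ddir (ddir Y b) c) a x"
    "ddir (ddir (ddir Y a) d) b x = ddir (ddir (ddir Y b) d) a x"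
    using c3 by metis+
  moreover have "ddir (ddir Y d) a x = ddir (ddir Y a) d x" "ddir (ddir Y d) b x = ddir (ddir Y b) d x"
    "ddir (ddir Y c) a x = ddir (ddir Y a) c x" "ddir (ddir Y c) b x = ddir (ddir Y b) c x"
    "ddir (ddir Y d) c x = ddir (ddir Y c) d x" "ddir (ddir Y b) a x = ddir (ddir Y a) b x"
    using c2 by metis+
  ultimately show ?thesis
    unfolding curvature2_def pullback_ddir2[OF x]
    by (simp add: sym[of "ddir Y _ x"] sym[of "ddir (ddir Y a) _ x" "ddir (ddir Y b) _ x"]
        sym[of "ddir (ddir Y c) d x" "ddir (ddir Y a) b x"])
qed

end

text \<open>The vectors \<open>\<Gamma> a b\<close> are the Christoffel symbols of the second kind. They are obtained as tangential
  components of the second derivatives of \<open>(Y, X)\<close>, so that no inverse metric is needed.\<close>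

lemma gauss_equation:
  fixes Y :: "'a::euclidean_space \<Rightarrow> 'y::euclidean_space" and X :: "'a \<Rightarrow> 'z::euclidean_space"
  assumes Y: "unit_immersion W \<beta>1 Y" and X: "unit_immersion W \<beta>2 X"
    and dim: "DIM('y) + DIM('z) = DIM('a) + 2"
    and x: "x \<in> W"
  defines "h1 \<equiv> pullback_form \<beta>1 Y" and "h2 \<equiv> pullback_form \<beta>2 X"
  assumes h: "\<And>u v y. y \<in> W \<Longrightarrow> h u v y = h1 u v y + h2 u v y"
    and nondeg: "\<And>u. (\<And>v. h u v x = 0) \<Longrightarrow> u = 0"
  shows "\<exists>\<Gamma>. (\<forall>a b m. h (\<Gamma> a b) m x = christoffel1 h a b m x) \<and>
    (\<forall>a b c d. h1 a c x * h1 b d x - h1 a d x * h1 b c x + (h2 a c x * h2 b d x - h2 a d x * h2 b c x)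
      = curvature2 h a b c d x - h (\<Gamma> a c) (\<Gamma> b d) x + h (\<Gamma> b c) (\<Gamma> a d) x)"
proof -
  interpret Y: unit_immersion W \<beta>1 Y by fact
  interpret X: unit_immersion W \<beta>2 X by fact
  interpret B1: bounded_bilinear \<beta>1 by (rule Y.bil)
  interpret B2: bounded_bilinear \<beta>2 by (rule X.bil)
  have linY: "linear (\<lambda>v. ddir Y v x)" and linX: "linear (\<lambda>v. ddir X v x)"
    using linear_ddir x Y.Ck_Y X.Ck_Y by blast+
  \<comment> \<open>Tangent vectors together with the two normals \<open>Y x\<close> and
    \<open>X x\<close>. Nondegeneracy makes the map injective, and the dimension hypothesis, with 2
    counting the normals, makes it bijective; hence every ambient vector has a tangential
    part.\<close>
  let ?L = "\<lambda>(m, \<alpha>, \<gamma>). (ddir Y m x + \<alpha> *\<^sub>R Y x, ddir X m x + \<gamma> *\<^sub>R X x)"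
  have linL: "linear ?L"
    by (auto intro!: linearI simp: linear_add[OF linY] linear_add[OF linX] linear_scale[OF linY]
        linear_scale[OF linX] algebra_simps)
  have "p = 0" if "?L p = 0" for p
  proof -
    obtain m \<alpha> \<gamma> where p: "p = (m, \<alpha>, \<gamma>)" by (cases p)
    then have 1: "ddir Y m x + \<alpha> *\<^sub>R Y x = 0" and 2: "ddir X m x + \<gamma> *\<^sub>R X x = 0"
      using that by (simp_all add: zero_prod_def)
    have "h m v x = 0" for v
    proof -
      have "h m v x = \<beta>1 (ddir Y m x + \<alpha> *\<^sub>R Y x) (ddir Y v x) + \<beta>2 (ddir X m x + \<gamma> *\<^sub>R X x) (ddir X v x)"
        using x by (simp add: h h1_def h2_def B1.add_left B1.scaleR_left B2.add_left B2.scaleR_left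
          Y.tangent_orthogonal X.tangent_orthogonal)
      then show ?thesis using 1 2 by (simp add: B1.zero_left B2.zero_left)
    qed
    then have m: "m = 0" by (rule nondeg)
    have "Y x \<noteq> 0" "X x \<noteq> 0"
      using Y.unit[OF x] X.unit[OF x] by (auto simp: B1.zero_left B2.zero_left)
    then show "p = 0"
      using 1 2 m by (simp add: p linear_0[OF linY] linear_0[OF linX] zero_prod_def)
  qed
  then have "inj ?L" unfolding linear_injective_0[OF linL] by blast
  with linL have "surj ?L"
    by (rule linear_injective_imp_surjective) (simp add: dim_UNIV dim)
  \<comment> \<open>The witness \<open>m\<close> is the covariant derivative of the constant field
    \<open>b\<close> along \<open>a\<close>. The coefficients of the normals are read off by pairing
    with \<open>Y x\<close> and \<open>X x\<close>.\<close>
  have "\<exists>m. ddir (ddir Y a) b x = ddir Y m x - h1 a b x *\<^sub>R Y x \<and>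
      ddir (ddir X a) b x = ddir X m x - h2 a b x *\<^sub>R X x" for a b
  proof -
    obtain p where "(ddir (ddir Y a) b x, ddir (ddir X a) b x) = ?L p"
      using surjD[OF \<open>surj ?L\<close>] by blast
    moreover obtain m \<alpha> \<gamma> where "p = (m, \<alpha>, \<gamma>)" by (cases p)
    ultimately have m: "ddir (ddir Y a) b x = ddir Y m x + \<alpha> *\<^sub>R Y x"
        "ddir (ddir X a) b x = ddir X m x + \<gamma> *\<^sub>R X x"
      by simp_all
    have "\<alpha> = - h1 a b x"
      using Y.normal_component[OF x, of a b] x unfolding m h1_def
      by (simp add: B1.add_right B1.scaleR_right Y.tangent_orthogonal Y.unit)
    moreover have "\<gamma> = - h2 a b x"
      using X.normal_component[OF x, of a b] x unfolding m h2_def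
      by (simp add: B2.add_right B2.scaleR_right X.tangent_orthogonal X.unit)
    ultimately show ?thesis using m by auto
  qed
  then obtain \<Gamma> where \<Gamma>: "ddir (ddir Y a) b x = ddir Y (\<Gamma> a b) x - h1 a b x *\<^sub>R Y x"
      "ddir (ddir X a) b x = ddir X (\<Gamma> a b) x - h2 a b x *\<^sub>R X x" for a b
    by metis
  note W = Y.op
  have d1: "h1 u v differentiable at y" "h2 u v differentiable at y"
     "ddir (h1 u v) c differentiable at y" "ddir (h2 u v) c differentiable at y" if "y \<in> W" for u v y c
    using Y.pullback_Ck X.pullback_Ck that unfolding h1_def h2_def by simp_all
  have dh: "ddir (h u v) c y = ddir (h1 u v) c y + ddir (h2 u v) c y" if "y \<in> W" for u v c y
    by (rule ddir_add[OF W that h d1(1,2)[OF that]])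
  have ddh: "ddir (ddir (h u v) c) d x = ddir (ddir (h1 u v) c) d x + ddir (ddir (h2 u v) c) d x" for u v c d
    by (rule ddir_add[OF W x dh d1(3,4)[OF x]])
  have chr: "christoffel1 h a b m x = christoffel1 h1 a b m x + christoffel1 h2 a b m x" for a b m
    unfolding christoffel1_def dh[OF x] by (simp add: field_simps)
  have cur: "curvature2 h a b c d x = curvature2 h1 a b c d x + curvature2 h2 a b c d x" for a b c d
    unfolding curvature2_def ddh by (simp add: field_simps)
  \<comment> \<open>The normal parts contribute the product of the forms with coefficient 1 because
    the normals are unit; antisymmetrised, this is the curvature of the factor.\<close>
  have prod1: "\<beta>1 (ddir (ddir Y a) b x) (ddir (ddir Y c) d x) = h1 (\<Gamma> a b) (\<Gamma> c d) x + h1 a b x * h1 c d x" for a b c d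
    unfolding \<Gamma> using x Y.tangent_orthogonal[OF x] Y.sym[of "ddir Y _ x" "Y x"]
    by (simp add: h1_def B1.diff_left B1.diff_right B1.scaleR_left B1.scaleR_right Y.unit)
  have prod2: "\<beta>2 (ddir (ddir X a) b x) (ddir (ddir X c) d x) = h2 (\<Gamma> a b) (\<Gamma> c d) x + h2 a b x * h2 c d x" for a b c d
    unfolding \<Gamma> using x X.tangent_orthogonal[OF x] X.sym[of "ddir X _ x" "X x"]
    by (simp add: h2_def B2.diff_left B2.diff_right B2.scaleR_left B2.scaleR_right X.unit)
  have "h (\<Gamma> a b) m x = christoffel1 h a b m x" for a b m
    unfolding chr h1_def h2_def Y.pullback_christoffel1[OF x] X.pullback_christoffel1[OF x] \<Gamma>
    using x by (simp add: h h1_def h2_def B1.diff_left B1.scaleR_left B2.diff_left B2.scaleR_left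
        Y.tangent_orthogonal X.tangent_orthogonal)
  moreover have "h1 a c x * h1 b d x - h1 a d x * h1 b c x + (h2 a c x * h2 b d x - h2 a d x * h2 b c x)
      = curvature2 h a b c d x - h (\<Gamma> a c) (\<Gamma> b d) x + h (\<Gamma> b c) (\<Gamma> a d) x" for a b c d
    unfolding cur h1_def[symmetric] h2_def[symmetric]
    using Y.pullback_curvature2[OF x, of a b c d] X.pullback_curvature2[OF x, of a b c d] x
    unfolding h1_def[symmetric] h2_def[symmetric] prod1 prod2
    by (simp add: h algebra_simps)
  ultimately show ?thesis by blast
qed

section \<open>Convergence of nondegenerate bilinear forms\<close>

text \<open>The functional \<open>f\<close> annihilates the range of \<open>L\<close>, which
  therefore has dimension at most \<open>DIM('y) - 1\<close>, so the kernel has dimension at least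
  2. Used with the derivative of a map into a quadric and the pairing with the unit normal.\<close>

lemma kernel_orthonormal_pair:
  fixes L :: "'a::euclidean_space \<Rightarrow> 'y::euclidean_space"
  assumes L: "linear L" and f: "linear f" "f y0 \<noteq> (0::real)" "\<And>u. f (L u) = 0"
    and dim: "DIM('y) + 1 \<le> DIM('a)"
  obtains u v where "L u = 0" "L v = 0" "norm u = 1" "norm v = 1" "u \<bullet> v = 0"
proof -
  define K where "K = {u. L u = 0}"
  define K' where "K' = {y \<in> UNIV. \<forall>x\<in>K. orthogonal x y}"
  have K: "subspace K" unfolding K_def by (rule linear_subspace_kernel[OF L])
  have K': "subspace K'" unfolding K'_def using subspace_orthogonal_to_vectors by simp
  have dimK: "dim K' + dim K = DIM('a)"
    using dim_subspace_orthogonal_to_vectors[OF K subspace_UNIV] unfolding K'_def by simp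
  \<comment> \<open>Rank and nullity: \<open>L\<close> is injective on the orthogonal complement of
    its kernel.\<close>
  have "inj_on L (span K')"
    unfolding span_eq_iff[THEN iffD2, OF K']
  proof (rule inj_onI)
    fix x y assume xy: "x \<in> K'" "y \<in> K'" "L x = L y"
    then have "x - y \<in> K" by (simp add: K_def linear_diff[OF L])
    moreover have "x - y \<in> K'" using xy K' by (simp add: subspace_diff)
    ultimately have "(x - y) \<bullet> (x - y) = 0" unfolding K'_def orthogonal_def by blast
    then show "x = y" by simp
  qed
  then have "dim (L ` K') = dim K'" by (rule dim_image_eq[OF L])
  moreover have "dim (L ` K') \<le> DIM('y) - 1"
  proof -
    \<comment> \<open>The vector representing \<open>f\<close> through the inner product, so that
      the range of \<open>L\<close> lies in its hyperplane.\<close>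
    define a where "a = (\<Sum>b\<in>Basis. f b *\<^sub>R b)"
    have fa: "f z = a \<bullet> z" for z
    proof -
      have "f z = f (\<Sum>b\<in>Basis. (z \<bullet> b) *\<^sub>R b)" by (simp add: euclidean_representation)
      also have "\<dots> = (\<Sum>b\<in>Basis. (z \<bullet> b) * f b)"
        by (simp add: linear_sum[OF f(1)] linear_scale[OF f(1)])
      also have "\<dots> = a \<bullet> z"
        by (subst inner_commute) (simp add: a_def inner_sum_right mult.commute)
      finally show ?thesis .
    qed
    then have "a \<noteq> 0" using f(2) by auto
    have "L ` K' \<subseteq> {z. a \<bullet> z = 0}" using f(3) fa by auto
    then have "dim (L ` K') \<le> dim {z. a \<bullet> z = 0}" by (rule dim_subset)
    then show ?thesis using dim_hyperplane[OF \<open>a \<noteq> 0\<close>] by simp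
  qed
  moreover have "DIM('y) > 0" by simp
  ultimately have "2 \<le> dim K" using dimK dim by linarith
  obtain B where B: "B \<subseteq> K" "pairwise orthogonal B" "\<And>x. x \<in> B \<Longrightarrow> norm x = 1"
      "independent B" "card B = dim K" "span B = K"
    using orthonormal_basis_subspace[OF K] by blast
  have "\<exists>u\<in>B. \<exists>v\<in>B. u \<noteq> v"
  proof (rule ccontr)
    assume "\<not> ?thesis"
    then have "card B \<le> Suc 0"
      using card_le_Suc0_iff_eq[OF independent_imp_finite[OF B(4)]] by blast
    then show False using B(5) \<open>2 \<le> dim K\<close> by simp
  qed
  then obtain u v where "u \<in> B" "v \<in> B" "u \<noteq> v" by blast
  then show ?thesis using B that[of u v] by (auto simp: K_def pairwise_def orthogonal_def)
qed

lemma bilinear_expand: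
  fixes B :: "'a::euclidean_space \<Rightarrow> 'a \<Rightarrow> real"
  assumes "bilinear B"
  shows "B a b = (\<Sum>i\<in>Basis. \<Sum>j\<in>Basis. (a \<bullet> i) * (b \<bullet> j) * B i j)"
proof -
  have l: "linear (\<lambda>x. B x y)" "linear (B x)" for x y using assms by (auto simp: bilinear_def)
  have "B a b = (\<Sum>i\<in>Basis. (a \<bullet> i) * B i b)"
    using linear_sum[OF l(1)[of b], of "\<lambda>i. (a \<bullet> i) *\<^sub>R i" Basis]
    by (simp add: euclidean_representation linear_scale[OF l(1)])
  also have "B i b = (\<Sum>j\<in>Basis. (b \<bullet> j) * B i j)" for i
    using linear_sum[OF l(2)[of i], of "\<lambda>j. (b \<bullet> j) *\<^sub>R j" Basis]
    by (simp add: euclidean_representation linear_scale[OF l(2)])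
  then have "(\<Sum>i\<in>Basis. (a \<bullet> i) * B i b)
      = (\<Sum>i\<in>Basis. (a \<bullet> i) * (\<Sum>j\<in>Basis. (b \<bullet> j) * B i j))"
    by (intro sum.cong) auto
  finally show ?thesis by (simp add: sum_distrib_left mult.assoc)
qed

text \<open>In finite dimension, convergence on pairs of basis vectors already controls moving
  arguments.\<close>

lemma tendsto_bilinear_forms:
  fixes B :: "nat \<Rightarrow> 'a::euclidean_space \<Rightarrow> 'a \<Rightarrow> real"
  assumes "\<And>n. bilinear (B n)" "bilinear B0" "\<And>u v. (\<lambda>n. B n u v) \<longlonglongrightarrow> B0 u v" "a \<longlonglongrightarrow> a0" "b \<longlonglongrightarrow> b0"
  shows "(\<lambda>n. B n (a n) (b n)) \<longlonglongrightarrow> B0 a0 b0"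
proof -
  have "(\<lambda>n. \<Sum>i\<in>Basis. \<Sum>j\<in>Basis. (a n \<bullet> i) * (b n \<bullet> j) * B n i j)
      \<longlonglongrightarrow> (\<Sum>i\<in>Basis. \<Sum>j\<in>Basis. (a0 \<bullet> i) * (b0 \<bullet> j) * B0 i j)"
    by (intro tendsto_intros assms(3-5))
  then show ?thesis
    by (simp only: bilinear_expand[OF assms(1), symmetric] bilinear_expand[OF assms(2), symmetric])
qed

lemma nondegenerate_injective:
  fixes B0 :: "'a::euclidean_space \<Rightarrow> 'a \<Rightarrow> real"
  assumes bil: "bilinear B0" and nondeg: "\<And>u. (\<And>v. B0 u v = 0) \<Longrightarrow> u = 0"
  shows "linear (\<lambda>u. \<Sum>i\<in>Basis. B0 u i *\<^sub>R i)" "inj (\<lambda>u. \<Sum>i\<in>Basis. B0 u i *\<^sub>R i)"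
proof -
  have l: "linear (\<lambda>x. B0 x y)" "linear (B0 x)" for x y using bil by (auto simp: bilinear_def)
  show lin: "linear (\<lambda>u. \<Sum>i\<in>Basis. B0 u i *\<^sub>R i)"
    by (rule linearI) (simp_all add: linear_add[OF l(1)] linear_scale[OF l(1)] scaleR_add_left
        sum.distrib scaleR_right.sum)
  have "u = 0" if "(\<Sum>i\<in>Basis. B0 u i *\<^sub>R i) = 0" for u
  proof (rule nondeg)
    fix v
    have "B0 u i = 0" if "i \<in> Basis" for i
      using \<open>(\<Sum>i\<in>Basis. B0 u i *\<^sub>R i) = 0\<close> inner_sum_left_Basis[OF that, of "B0 u"] by simp
    then show "B0 u v = 0" using linear_eq_0_on_span[OF l(2), of Basis u v] by simp
  qed
  then show "inj (\<lambda>u. \<Sum>i\<in>Basis. B0 u i *\<^sub>R i)" unfolding linear_injective_0[OF lin] by blast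
qed

text \<open>In finite dimension the injective lowering of an index is surjective. This supplies the
  gradient of \<Omega> at the boundary point.\<close>

lemma bilinear_represents_functional:
  fixes B0 :: "'a::euclidean_space \<Rightarrow> 'a \<Rightarrow> real"
  assumes bil: "bilinear B0" and nondeg: "\<And>u. (\<And>v. B0 u v = 0) \<Longrightarrow> u = 0" and f: "linear f"
  obtains N where "\<And>v. B0 N v = f v"
proof -
  have l: "linear (B0 x)" for x using bil by (auto simp: bilinear_def)
  have surj: "surj (\<lambda>u. \<Sum>i\<in>Basis. B0 u i *\<^sub>R i)"
    using nondegenerate_injective[OF bil nondeg] by (rule linear_inj_imp_surj)
  then obtain N where N: "(\<Sum>i\<in>Basis. f i *\<^sub>R i) = (\<Sum>i\<in>Basis. B0 N i *\<^sub>R i)"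
    using surjD[OF surj] by blast
  have "B0 N i = f i" if "i \<in> Basis" for i
    using arg_cong[OF N, of "\<lambda>x. x \<bullet> i"] that by simp
  then have "B0 N v = f v" for v
    using linear_eq_on_span[OF l f, of Basis N] by simp
  then show ?thesis by (rule that)
qed

text \<open>Replaces the convergence of inverse matrices: an index can be raised in the limit, since
  the limit form is bounded below by some \<open>\<delta> > 0\<close> and the forms
  \<open>B n\<close> eventually differ from it by less than half of that.\<close>

lemma tendsto_of_bilinear_tendsto:
  fixes B :: "nat \<Rightarrow> 'a::euclidean_space \<Rightarrow> 'a \<Rightarrow> real"
  assumes bil: "\<And>n. bilinear (B n)" "bilinear B0" and nondeg: "\<And>u. (\<And>v. B0 u v = 0) \<Longrightarrow> u = 0"
    and lim: "\<And>u v. (\<lambda>n. B n u v) \<longlonglongrightarrow> B0 u v" "\<And>v. (\<lambda>n. B n (a n) v) \<longlonglongrightarrow> B0 a0 v"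
  shows "a \<longlonglongrightarrow> a0"
proof -
  have l: "linear (\<lambda>x. B0 x y)" "linear (\<lambda>x. B n x y)" for y n using bil by (auto simp: bilinear_def)
  obtain \<delta> where \<delta>: "\<delta> > 0" "\<And>u. \<delta> * norm u \<le> norm (\<Sum>i\<in>Basis. B0 u i *\<^sub>R i)"
    using linear_inj_bounded_below_pos[OF nondegenerate_injective[OF bil(2) nondeg]] by metis
  define \<eta> where "\<eta> n = (\<Sum>i\<in>Basis. \<Sum>j\<in>Basis. \<bar>B n j i - B0 j i\<bar>)" for n
  define \<mu> where "\<mu> n = (\<Sum>i\<in>Basis. \<bar>B n (a n) i - B n a0 i\<bar>)" for n
  have diff: "\<bar>B n u i - B0 u i\<bar> \<le> norm u * (\<Sum>j\<in>Basis. \<bar>B n j i - B0 j i\<bar>)" for n u i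
  proof -
    have "linear (\<lambda>x. B n x i - B0 x i)" by (rule linear_compose_sub[OF l(2) l(1)])
    then have "B n u i - B0 u i = (\<Sum>j\<in>Basis. (u \<bullet> j) * (B n j i - B0 j i))"
      using linear_sum[of "\<lambda>x. B n x i - B0 x i" "\<lambda>j. (u \<bullet> j) *\<^sub>R j" Basis]
        linear_scale[of "\<lambda>x. B n x i - B0 x i"]
      by (simp add: euclidean_representation)
    also have "\<bar>\<dots>\<bar> \<le> (\<Sum>j\<in>Basis. norm u * \<bar>B n j i - B0 j i\<bar>)"
      by (intro order.trans[OF sum_abs] sum_mono) (auto simp: abs_mult Basis_le_norm intro: mult_right_mono)
    finally show ?thesis by (simp add: sum_distrib_left)
  qed
  \<comment> \<open>Lower bound for \<open>B0\<close> on the difference \<open>a n - a0\<close>,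
    with \<open>B0\<close> replaced by \<open>B n\<close> at the cost of
    \<open>\<eta> n\<close>.\<close>
  have est: "(\<delta> - \<eta> n) * norm (a n - a0) \<le> \<mu> n" for n
  proof -
    let ?u = "a n - a0"
    have "\<delta> * norm ?u \<le> (\<Sum>i\<in>Basis. norm (B0 ?u i *\<^sub>R i))"
      using \<delta>(2)[of ?u] norm_sum[of "\<lambda>i. B0 ?u i *\<^sub>R i" Basis] by linarith
    also have "\<dots> = (\<Sum>i\<in>Basis. \<bar>B0 ?u i\<bar>)" by simp
    also have "\<dots> \<le> (\<Sum>i\<in>Basis. \<bar>B n (a n) i - B n a0 i\<bar> + norm ?u * (\<Sum>j\<in>Basis. \<bar>B n j i - B0 j i\<bar>))"
    proof (rule sum_mono)
      fix i :: 'a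
      have "B n ?u i = B n (a n) i - B n a0 i" using l(2) by (rule linear_diff)
      then show "\<bar>B0 ?u i\<bar> \<le> \<bar>B n (a n) i - B n a0 i\<bar> + norm ?u * (\<Sum>j\<in>Basis. \<bar>B n j i - B0 j i\<bar>)"
        using diff[of n ?u i] by linarith
    qed
    also have "\<dots> = \<mu> n + norm ?u * \<eta> n" by (simp add: \<mu>_def \<eta>_def sum.distrib sum_distrib_left)
    finally show ?thesis by (simp add: algebra_simps)
  qed
  have "\<eta> \<longlonglongrightarrow> (\<Sum>i\<in>Basis. \<Sum>j\<in>Basis. \<bar>B0 j i - B0 j i\<bar>)"
    unfolding \<eta>_def by (intro tendsto_intros lim)
  then have \<eta>: "\<eta> \<longlonglongrightarrow> 0" by simp
  have "\<mu> \<longlonglongrightarrow> (\<Sum>i\<in>Basis. \<bar>B0 a0 i - B0 a0 i\<bar>)"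
    unfolding \<mu>_def by (intro tendsto_intros lim)
  then have \<mu>: "(\<lambda>n. 2 / \<delta> * \<mu> n) \<longlonglongrightarrow> 0" using tendsto_mult_left[of \<mu> 0 _ "2 / \<delta>"] by simp
  have "eventually (\<lambda>n. \<eta> n < \<delta> / 2) sequentially"
    using \<eta> \<delta>(1) by (intro order_tendstoD) auto
  then have "eventually (\<lambda>n. norm (a n - a0) \<le> 2 / \<delta> * \<mu> n) sequentially"
  proof eventually_elim
    case (elim n)
    then have "\<delta> / 2 * norm (a n - a0) \<le> (\<delta> - \<eta> n) * norm (a n - a0)"
      by (intro mult_right_mono) auto
    then have "\<delta> / 2 * norm (a n - a0) \<le> \<mu> n" using est[of n] by linarith
    then show ?case using \<delta>(1) by (simp add: field_simps)
  qed
  from Lim_null_comparison[OF this \<mu>] show ?thesis by (simp add: LIM_zero_iff)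
qed

lemma lorentzian_form_nondegenerate:
  assumes "lorentzian_form b" "\<And>v. b u v = 0"
  shows "u = 0"
proof -
  obtain E e where E: "independent E" "span E = UNIV" "e \<in> E" "b e e = -1" "\<forall>x\<in>E - {e}. b x x = 1"
      "\<forall>x\<in>E. \<forall>y\<in>E. x \<noteq> y \<longrightarrow> b x y = 0" and bil: "bilinear b"
    using assms(1) unfolding lorentzian_form_def by blast
  have l: "linear (\<lambda>x. b x y)" for y using bil by (auto simp: bilinear_def)
  have fin: "finite E" using E(1) by (rule independent_imp_finite)
  obtain c where c: "u = (\<Sum>x\<in>E. c x *\<^sub>R x)"
    using E(2) span_finite[OF fin] by blast
  have "c y = 0" if y: "y \<in> E" for y
  proof -
    have "0 = b u y" using assms(2) by simp
    also have "\<dots> = (\<Sum>x\<in>E. c x * b x y)" unfolding c by (simp add: linear_sum[OF l] linear_scale[OF l])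
    also have "\<dots> = (\<Sum>x\<in>E. if x = y then c y * b y y else 0)"
      using E(6) y by (intro sum.cong) auto
    also have "\<dots> = c y * b y y" using fin y by simp
    finally show "c y = 0" using E(4,5) y by (cases "y = e") auto
  qed
  then show ?thesis by (simp add: c)
qed

text \<open>Pick \<open>d\<close> with \<open>B0 a d\<close> nonzero. The hypothesis then says that
  the combination of \<open>b\<close> and \<open>a\<close> that pairs to zero with \<open>d\<close>
  pairs to zero with everything, so it vanishes.\<close>

lemma wedge_zero_dependent:
  fixes B0 :: "'a::euclidean_space \<Rightarrow> 'a \<Rightarrow> real"
  assumes bil: "bilinear B0" and nondeg: "\<And>u. (\<And>v. B0 u v = 0) \<Longrightarrow> u = 0"
    and wedge: "\<And>c d. B0 a c * B0 b d - B0 a d * B0 b c = 0" and a: "a \<noteq> 0"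
  shows "\<exists>r. b = r *\<^sub>R a"
proof -
  have l: "linear (\<lambda>x. B0 x y)" for y using bil by (auto simp: bilinear_def)
  obtain d where d: "B0 a d \<noteq> 0" using nondeg a by blast
  have "B0 (B0 a d *\<^sub>R b - B0 b d *\<^sub>R a) c = 0" for c
    using wedge[of c d] by (simp add: linear_diff[OF l] linear_scale[OF l] algebra_simps)
  then have "B0 a d *\<^sub>R b = B0 b d *\<^sub>R a" using nondeg by (metis eq_iff_diff_eq_0)
  then have "b = (B0 b d / B0 a d) *\<^sub>R a" using d by (metis (no_types) divide_inverse_commute scaleR_scaleR scaleR_one left_inverse)
  then show ?thesis by blast
qed

section \<open>Curvature near conformal infinity\<close>

lemma ddir_divide_power:
  fixes f \<Omega> :: "'a::euclidean_space \<Rightarrow> real"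
  assumes "Ck_on (Suc 0) W f" "Ck_on (Suc 0) W \<Omega>" "x \<in> W" "\<Omega> x > 0"
  shows "ddir (\<lambda>x. f x / \<Omega> x ^ n) c x = ddir f c x / \<Omega> x ^ n - n * (f x * ddir \<Omega> c x) / \<Omega> x ^ Suc n"
proof (rule ddir_eqI)
  note d = Ck_on_SucD[OF assms(1,3)] Ck_on_SucD[OF assms(2,3)]
  \<comment> \<open>The power rule yields the exponent \<open>n - 1\<close>. At \<open>n = 0\<close>
    the subtraction is truncated, but there the term has the factor 0.\<close>
  have "\<Omega> x * \<Omega> x ^ (n - 1) = \<Omega> x ^ n" if "n > 0"
    using that by (simp add: power_eq_if)
  then show "((\<lambda>x. f x / \<Omega> x ^ n) has_derivative
      (\<lambda>c. ddir f c x / \<Omega> x ^ n - n * (f x * ddir \<Omega> c x) / \<Omega> x ^ Suc n)) (at x)"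
    using assms(4) d by (auto intro!: derivative_eq_intros simp: fun_eq_iff field_simps)
qed

text \<open>All analysis takes place on the open set \<open>W\<close> off the boundary, where full
  derivatives make sense. The boundary point enters through limits along \<open>p\<close>, with
  \<open>G0\<close> and \<omega> in the roles of the metric and of the differential of \<Omega>
  there. Smoothness up to the boundary has become the existence of limits of the
  derivatives.\<close>

locale conformal_asymptotics =
  fixes W :: "'a::euclidean_space set" and p :: "nat \<Rightarrow> 'a" and \<Omega> :: "'a \<Rightarrow> real"
    and G :: "'a \<Rightarrow> 'a \<Rightarrow> 'a \<Rightarrow> real" and \<omega> :: "'a \<Rightarrow> real" and G0 :: "'a \<Rightarrow> 'a \<Rightarrow> real"
  assumes op: "open W" and p: "p n \<in> W"
    and \<Omega>_Ck: "Ck_on (Suc (Suc 0)) W \<Omega>" and \<Omega>_pos: "x \<in> W \<Longrightarrow> \<Omega> x > 0"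
    and G_Ck: "Ck_on (Suc (Suc 0)) W (G u v)"
    and G_bil: "x \<in> W \<Longrightarrow> bilinear (\<lambda>u v. G u v x)" and G_sym: "x \<in> W \<Longrightarrow> G u v x = G v u x"
    and G_nondeg: "x \<in> W \<Longrightarrow> (\<And>v. G u v x = 0) \<Longrightarrow> u = 0"
    and G0_bil: "bilinear G0" and G0_sym: "G0 u v = G0 v u" and G0_nondeg: "(\<And>v. G0 u v = 0) \<Longrightarrow> u = 0"
    and \<omega>_lin: "linear \<omega>"
    and \<Omega>_lim: "(\<lambda>n. \<Omega> (p n)) \<longlonglongrightarrow> 0" "(\<lambda>n. ddir \<Omega> v (p n)) \<longlonglongrightarrow> \<omega> v"
      "\<exists>l. (\<lambda>n. ddir (ddir \<Omega> v) w (p n)) \<longlonglongrightarrow> l"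
    and G_lim: "(\<lambda>n. G u v (p n)) \<longlonglongrightarrow> G0 u v" "\<exists>l. (\<lambda>n. ddir (G u v) c (p n)) \<longlonglongrightarrow> l"
      "\<exists>l. (\<lambda>n. ddir (ddir (G u v) c) d (p n)) \<longlonglongrightarrow> l"
begin

definition h :: "'a \<Rightarrow> 'a \<Rightarrow> 'a \<Rightarrow> real" where
  "h u v x = G u v x / (\<Omega> x)\<^sup>2"

lemma Ck1: "Ck_on (Suc 0) W \<Omega>" "Ck_on (Suc 0) W (ddir \<Omega> v)" "Ck_on (Suc 0) W (G u v)" "Ck_on (Suc 0) W (ddir (G u v) c)"
proof -
  show "Ck_on (Suc 0) W \<Omega>" "Ck_on (Suc 0) W (G u v)"
    by (rule Ck_on_Suc_imp[OF \<Omega>_Ck], rule Ck_on_Suc_imp[OF G_Ck])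
  show "Ck_on (Suc 0) W (ddir \<Omega> v)" "Ck_on (Suc 0) W (ddir (G u v) c)"
    using \<Omega>_Ck G_Ck[of u v] by (subst (asm) (1 2) Ck_on.simps(2), blast)+
qed

lemma ddir_h:
  assumes x: "x \<in> W"
  shows "ddir (h u v) c x = ddir (G u v) c x / (\<Omega> x)\<^sup>2 - 2 * (G u v x * ddir \<Omega> c x) / \<Omega> x ^ 3"
  using ddir_divide_power[OF Ck1(3) Ck1(1) x \<Omega>_pos[OF x], of u v 2 c]
  by (simp add: h_def[abs_def] eval_nat_numeral)

lemma ddir_ddir_h:
  assumes x: "x \<in> W"
  shows "ddir (ddir (h u v) c) d x = ddir (ddir (G u v) c) d x / (\<Omega> x)\<^sup>2
     - 2 * (ddir (G u v) c x * ddir \<Omega> d x) / \<Omega> x ^ 3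
     - 2 * (ddir (G u v) d x * ddir \<Omega> c x + G u v x * ddir (ddir \<Omega> c) d x) / \<Omega> x ^ 3
     + 6 * (G u v x * ddir \<Omega> c x * ddir \<Omega> d x) / \<Omega> x ^ 4"
proof -
  define P where "P = (\<lambda>x. -2 * (G u v x * ddir \<Omega> c x))"
  have Ckp: "Ck_on (Suc 0) W P"
    unfolding P_def by (intro Ck_on_mult Ck_on_const op Ck1)
  have Ckd: "Ck_on (Suc 0) W (\<lambda>x. f x / \<Omega> x ^ n)" if "Ck_on (Suc 0) W f" for f n
  proof -
    have "Ck_on (Suc 0) W (\<lambda>x. \<Omega> x ^ n)"
      by (induction n) (auto intro!: Ck_on_const Ck_on_mult op Ck1 simp del: Ck_on.simps)
    then show ?thesis using \<Omega>_pos by (intro Ck_on_divide op that) force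
  qed
  have eq: "ddir (h u v) c y = ddir (G u v) c y / \<Omega> y ^ 2 + P y / \<Omega> y ^ 3"
    if "y \<in> W" for y
    using ddir_h[OF that, of u v c] by (simp add: P_def)
  have "ddir (ddir (h u v) c) d x = ddir (\<lambda>y. ddir (G u v) c y / \<Omega> y ^ 2) d x
      + ddir (\<lambda>y. P y / \<Omega> y ^ 3) d x"
    using Ckd[OF Ck1(4), of u v c 2] Ckd[OF Ckp, of 3] x
    by (intro ddir_add[OF op x eq]) (auto simp only: Ck_on.simps(2))
  also have "\<dots> = ddir (ddir (G u v) c) d x / \<Omega> x ^ 2 - 2 * (ddir (G u v) c x * ddir \<Omega> d x) / \<Omega> x ^ 3
      + (ddir P d x / \<Omega> x ^ 3 - 3 * (P x * ddir \<Omega> d x) / \<Omega> x ^ 4)"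
    using ddir_divide_power[OF Ck1(4) Ck1(1) x \<Omega>_pos[OF x], of u v c 2 d]
      ddir_divide_power[OF Ckp Ck1(1) x \<Omega>_pos[OF x], of 3 d]
    by simp
  also have "ddir P d x = -2 * (ddir (G u v) d x * ddir \<Omega> c x + G u v x * ddir (ddir \<Omega> c) d x)"
    using Ck_on_SucD[OF Ck1(2) x] Ck_on_SucD[OF Ck1(3) x, of u v]
    unfolding P_def by (intro ddir_eqI) (auto intro!: derivative_eq_intros)
  finally show ?thesis by (simp add: P_def diff_divide_distrib add_divide_distrib algebra_simps)
qed

lemma tendsto_ddir_h: "(\<lambda>n. \<Omega> (p n) ^ 3 * ddir (h u v) c (p n)) \<longlonglongrightarrow> - 2 * (G0 u v * \<omega> c)"
proof -
  obtain l where l: "(\<lambda>n. ddir (G u v) c (p n)) \<longlonglongrightarrow> l" using G_lim(2) by blast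
  have "(\<lambda>n. \<Omega> (p n) * ddir (G u v) c (p n) - 2 * (G u v (p n) * ddir \<Omega> c (p n)))
      \<longlonglongrightarrow> 0 * l - 2 * (G0 u v * \<omega> c)"
    by (intro tendsto_intros \<Omega>_lim G_lim l)
  moreover have "\<Omega> (p n) ^ 3 * ddir (h u v) c (p n)
      = \<Omega> (p n) * ddir (G u v) c (p n) - 2 * (G u v (p n) * ddir \<Omega> c (p n))" for n
    using \<Omega>_pos[OF p, of n] by (simp add: ddir_h[OF p] field_simps eval_nat_numeral)
  ultimately show ?thesis by simp
qed

text \<open>Each derivative costs one power of \<Omega>. Only the term in which both derivatives
  fall on \<open>\<Omega>\<^sup>-\<^sup>2\<close> reaches the order -4, with coefficient (-2)(-3) =
  6; every other term keeps a factor \<Omega> next to a convergent one.\<close>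

lemma tendsto_ddir_ddir_h:
  "(\<lambda>n. \<Omega> (p n) ^ 4 * ddir (ddir (h u v) c) d (p n)) \<longlonglongrightarrow> 6 * (G0 u v * \<omega> c * \<omega> d)"
proof -
  obtain l1 l2 l3 l4 where l: "(\<lambda>n. ddir (ddir (G u v) c) d (p n)) \<longlonglongrightarrow> l1"
      "(\<lambda>n. ddir (G u v) c (p n)) \<longlonglongrightarrow> l2" "(\<lambda>n. ddir (G u v) d (p n)) \<longlonglongrightarrow> l3"
      "(\<lambda>n. ddir (ddir \<Omega> c) d (p n)) \<longlonglongrightarrow> l4"
    using G_lim(2,3) \<Omega>_lim(3) by meson
  have "(\<lambda>n. \<Omega> (p n) ^ 2 * ddir (ddir (G u v) c) d (p n)
      - 2 * \<Omega> (p n) * (ddir (G u v) c (p n) * ddir \<Omega> d (p n))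
      - 2 * \<Omega> (p n) * (ddir (G u v) d (p n) * ddir \<Omega> c (p n) + G u v (p n) * ddir (ddir \<Omega> c) d (p n))
      + 6 * (G u v (p n) * ddir \<Omega> c (p n) * ddir \<Omega> d (p n)))
      \<longlonglongrightarrow> 0 ^ 2 * l1 - 2 * 0 * (l2 * \<omega> d) - 2 * 0 * (l3 * \<omega> c + G0 u v * l4)
        + 6 * (G0 u v * \<omega> c * \<omega> d)"
    by (intro tendsto_intros \<Omega>_lim G_lim l)
  moreover have "\<Omega> (p n) ^ 4 * ddir (ddir (h u v) c) d (p n) = \<Omega> (p n) ^ 2 * ddir (ddir (G u v) c) d (p n)
      - 2 * \<Omega> (p n) * (ddir (G u v) c (p n) * ddir \<Omega> d (p n))
      - 2 * \<Omega> (p n) * (ddir (G u v) d (p n) * ddir \<Omega> c (p n) + G u v (p n) * ddir (ddir \<Omega> c) d (p n))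
      + 6 * (G u v (p n) * ddir \<Omega> c (p n) * ddir \<Omega> d (p n))" for n
    using \<Omega>_pos[OF p, of n] by (simp add: ddir_ddir_h[OF p] field_simps eval_nat_numeral)
  ultimately show ?thesis by simp
qed

text \<open>Since \<open>\<Omega> \<Gamma> a b\<close> tends to \<open>S a b = G0 a b N - \<omega> a b - \<omega> b a\<close> with \<open>N\<close> the gradient of \<open>\<Omega>\<close>, the terms
  quadratic in \<open>\<omega>\<close> cancel and only \<open>k = - G0 N N\<close> survives.\<close>

lemma tendsto_curvature:
  assumes \<Gamma>: "\<And>n a b m. h (\<Gamma> n a b) m (p n) = christoffel1 h a b m (p n)"
  shows "\<exists>k. \<forall>a b c d. (\<lambda>n. \<Omega> (p n) ^ 4 * (curvature2 h a b c d (p n)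
        - h (\<Gamma> n a c) (\<Gamma> n b d) (p n) + h (\<Gamma> n b c) (\<Gamma> n a d) (p n)))
      \<longlonglongrightarrow> k * (G0 a c * G0 b d - G0 a d * G0 b c)"
proof -
  have lG: "linear (\<lambda>x. G x y (p n))" "linear (\<lambda>y. G x y (p n))" for x y n
    using G_bil[OF p, of n] by (auto simp: bilinear_def)
  have l0: "linear (\<lambda>x. G0 x y)" "linear (G0 x)" for x y using G0_bil by (auto simp: bilinear_def)
  obtain N where N: "\<And>v. G0 N v = \<omega> v"
    using bilinear_represents_functional[OF G0_bil G0_nondeg \<omega>_lin] by blast
  define S where "S a b = G0 a b *\<^sub>R N - \<omega> a *\<^sub>R b - \<omega> b *\<^sub>R a" for a b
  \<comment> \<open>Only the lowered symbols are given by derivatives of \<open>h\<close>. Lowering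
    with \<open>G\<close> instead of \<open>h\<close> accounts for two of the three powers of
    \<Omega>, the third being the weight of \<open>\<Gamma>\<close>.\<close>
  have lim\<Gamma>: "(\<lambda>n. \<Omega> (p n) *\<^sub>R \<Gamma> n a b) \<longlonglongrightarrow> S a b" for a b
  proof (rule tendsto_of_bilinear_tendsto[OF G_bil[OF p] G0_bil G0_nondeg G_lim(1)])
    fix m
    have "G (\<Omega> (p n) *\<^sub>R \<Gamma> n a b) m (p n) = \<Omega> (p n) ^ 3 * h (\<Gamma> n a b) m (p n)" for n
      using \<Omega>_pos[OF p, of n] by (simp add: linear_scale[OF lG(1)] h_def eval_nat_numeral)
    then have eq: "G (\<Omega> (p n) *\<^sub>R \<Gamma> n a b) m (p n) = (\<Omega> (p n) ^ 3 * ddir (h b m) a (p n)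
        + \<Omega> (p n) ^ 3 * ddir (h a m) b (p n) - \<Omega> (p n) ^ 3 * ddir (h a b) m (p n)) / 2" for n
      by (simp add: \<Gamma> christoffel1_def algebra_simps)
    have "(\<lambda>n. G (\<Omega> (p n) *\<^sub>R \<Gamma> n a b) m (p n))
        \<longlonglongrightarrow> (- 2 * (G0 b m * \<omega> a) + - 2 * (G0 a m * \<omega> b) - - 2 * (G0 a b * \<omega> m)) / 2"
      unfolding eq by (intro tendsto_add tendsto_diff tendsto_divide tendsto_const tendsto_ddir_h) simp
    moreover have "(- 2 * (G0 b m * \<omega> a) + - 2 * (G0 a m * \<omega> b) - - 2 * (G0 a b * \<omega> m)) / 2 = G0 (S a b) m"
      by (simp add: S_def linear_diff[OF l0(1)] linear_scale[OF l0(1)] N field_simps del: diff_diff_add)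
    ultimately show "(\<lambda>n. G (\<Omega> (p n) *\<^sub>R \<Gamma> n a b) m (p n)) \<longlonglongrightarrow> G0 (S a b) m" by simp
  qed
  \<comment> \<open>Of the four powers, two turn \<open>h\<close> into \<open>G\<close> and each
    copy of \<open>\<Gamma>\<close> absorbs one.\<close>
  have quad: "(\<lambda>n. \<Omega> (p n) ^ 4 * h (\<Gamma> n a b) (\<Gamma> n c d) (p n)) \<longlonglongrightarrow> G0 (S a b) (S c d)" for a b c d
  proof -
    have "\<Omega> (p n) ^ 4 * h (\<Gamma> n a b) (\<Gamma> n c d) (p n)
        = G (\<Omega> (p n) *\<^sub>R \<Gamma> n a b) (\<Omega> (p n) *\<^sub>R \<Gamma> n c d) (p n)" for n
      using \<Omega>_pos[OF p, of n]
      by (simp add: linear_scale[OF lG(1)] linear_scale[OF lG(2)] h_def eval_nat_numeral)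
    then show ?thesis
      using tendsto_bilinear_forms[OF G_bil[OF p] G0_bil G_lim(1) lim\<Gamma>[of a b] lim\<Gamma>[of c d]] by simp
  qed
  have curv: "(\<lambda>n. \<Omega> (p n) ^ 4 * curvature2 h a b c d (p n)) \<longlonglongrightarrow>
     (6 * (G0 a d * \<omega> c * \<omega> b) + 6 * (G0 b c * \<omega> d * \<omega> a)
      - 6 * (G0 b d * \<omega> c * \<omega> a) - 6 * (G0 a c * \<omega> d * \<omega> b)) / 2" for a b c d
  proof -
    have "\<Omega> (p n) ^ 4 * curvature2 h a b c d (p n)
       = (\<Omega> (p n) ^ 4 * ddir (ddir (h a d) c) b (p n) + \<Omega> (p n) ^ 4 * ddir (ddir (h b c) d) a (p n)
         - \<Omega> (p n) ^ 4 * ddir (ddir (h b d) c) a (p n) - \<Omega> (p n) ^ 4 * ddir (ddir (h a c) d) b (p n)) / 2" for n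
      by (simp add: curvature2_def algebra_simps)
    then show ?thesis
      by (simp only:) (intro tendsto_add tendsto_diff tendsto_divide tendsto_const tendsto_ddir_ddir_h, simp)
  qed
  have "(\<lambda>n. \<Omega> (p n) ^ 4 * (curvature2 h a b c d (p n)
        - h (\<Gamma> n a c) (\<Gamma> n b d) (p n) + h (\<Gamma> n b c) (\<Gamma> n a d) (p n)))
      \<longlonglongrightarrow> - G0 N N * (G0 a c * G0 b d - G0 a d * G0 b c)" for a b c d
  proof -
    have "(\<lambda>n. \<Omega> (p n) ^ 4 * curvature2 h a b c d (p n)
        - \<Omega> (p n) ^ 4 * h (\<Gamma> n a c) (\<Gamma> n b d) (p n) + \<Omega> (p n) ^ 4 * h (\<Gamma> n b c) (\<Gamma> n a d) (p n))
      \<longlonglongrightarrow> (6 * (G0 a d * \<omega> c * \<omega> b) + 6 * (G0 b c * \<omega> d * \<omega> a)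
        - 6 * (G0 b d * \<omega> c * \<omega> a) - 6 * (G0 a c * \<omega> d * \<omega> b)) / 2
        - G0 (S a c) (S b d) + G0 (S b c) (S a d)"
      by (intro tendsto_add tendsto_diff curv quad)
    \<comment> \<open>A term such as \<open>G0 a d * \<omega> b * \<omega> c\<close> gets 3 from the
      second derivatives and -1 and -2 from the two products. The terms with \<open>G0 a b\<close>
      and \<open>G0 c d\<close> cancel between the products.\<close>
    moreover have "(6 * (G0 a d * \<omega> c * \<omega> b) + 6 * (G0 b c * \<omega> d * \<omega> a)
        - 6 * (G0 b d * \<omega> c * \<omega> a) - 6 * (G0 a c * \<omega> d * \<omega> b)) / 2
        - G0 (S a c) (S b d) + G0 (S b c) (S a d) = - G0 N N * (G0 a c * G0 b d - G0 a d * G0 b c)"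
    proof -
      have N': "G0 v N = \<omega> v" for v using N G0_sym by metis
      have "G0 (S a c) (S b d) = G0 a c * G0 b d * G0 N N - 2 * G0 a c * \<omega> b * \<omega> d
          - 2 * G0 b d * \<omega> a * \<omega> c + \<omega> a * \<omega> b * G0 c d + \<omega> a * \<omega> d * G0 b c
          + \<omega> c * \<omega> b * G0 a d + \<omega> c * \<omega> d * G0 a b" for a b c d
        unfolding S_def linear_diff[OF l0(1)] linear_diff[OF l0(2)] linear_scale[OF l0(1)]
          linear_scale[OF l0(2)] linear_diff[OF \<omega>_lin] linear_scale[OF \<omega>_lin] N N'
        by (simp add: G0_sym[of c b] G0_sym[of d a] algebra_simps)
      note S = this[of a c b d] this[of b c a d]
      show ?thesis
        by (simp only: S N) (simp add: G0_sym[of b a] field_simps)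
    qed
    moreover have "\<Omega> (p n) ^ 4 * (A - B + C) = \<Omega> (p n) ^ 4 * A - \<Omega> (p n) ^ 4 * B + \<Omega> (p n) ^ 4 * C" for n A B C
      by (simp add: algebra_simps)
    ultimately show ?thesis by (simp only:)
  qed
  then show ?thesis by blast
qed

end

lemma no_conformal_infinity_of_product:
  fixes Y :: "'a::euclidean_space \<Rightarrow> 'y::euclidean_space" and X :: "'a \<Rightarrow> 'z::euclidean_space"
  assumes "conformal_asymptotics W p \<Omega> G \<omega> G0"
    and Y: "unit_immersion W \<beta>1 Y" and X: "unit_immersion W \<beta>2 X"
    and dim: "DIM('y) + DIM('z) = DIM('a) + 2" "DIM('y) + 1 \<le> DIM('a)" "DIM('z) + 1 \<le> DIM('a)"
    and metric: "\<And>u v x. x \<in> W \<Longrightarrow> G u v x / (\<Omega> x)\<^sup>2 = pullback_form \<beta>1 Y u v x + pullback_form \<beta>2 X u v x"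
  shows False
proof -
  interpret conformal_asymptotics W p \<Omega> G \<omega> G0 by fact
  interpret Y: unit_immersion W \<beta>1 Y by fact
  interpret X: unit_immersion W \<beta>2 X by fact
  interpret B1: bounded_bilinear \<beta>1 by (rule Y.bil)
  interpret B2: bounded_bilinear \<beta>2 by (rule X.bil)
  let ?h1 = "pullback_form \<beta>1 Y" and ?h2 = "pullback_form \<beta>2 X"
  have hs: "h u v x = ?h1 u v x + ?h2 u v x" if "x \<in> W" for u v x
    using metric[OF that] by (simp add: h_def)
  have linY: "linear (\<lambda>v. ddir Y v (p n))" and linX: "linear (\<lambda>v. ddir X v (p n))" for n
    using linear_ddir p Y.Ck_Y X.Ck_Y by blast+
  have l0: "linear (\<lambda>x. G0 x y)" "linear (G0 x)" for x y using G0_bil by (auto simp: bilinear_def)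
  have nd: "u = 0" if "\<And>v. h u v (p n) = 0" for u n
    using that \<Omega>_pos[OF p, of n] by (intro G_nondeg[OF p[of n]]) (force simp: h_def)
  have "\<forall>n. \<exists>\<Gamma>. (\<forall>a b m. h (\<Gamma> a b) m (p n) = christoffel1 h a b m (p n)) \<and>
    (\<forall>a b c d. ?h1 a c (p n) * ?h1 b d (p n) - ?h1 a d (p n) * ?h1 b c (p n)
      + (?h2 a c (p n) * ?h2 b d (p n) - ?h2 a d (p n) * ?h2 b c (p n))
      = curvature2 h a b c d (p n) - h (\<Gamma> a c) (\<Gamma> b d) (p n) + h (\<Gamma> b c) (\<Gamma> a d) (p n))"
    by (intro allI gauss_equation[OF Y X dim(1) p]) (rule hs, assumption, rule nd)
  from choice[OF this] obtain \<Gamma> where \<Gamma>: "\<And>n a b m. h (\<Gamma> n a b) m (p n) = christoffel1 h a b m (p n)"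
    and curv: "\<And>n a b c d. ?h1 a c (p n) * ?h1 b d (p n) - ?h1 a d (p n) * ?h1 b c (p n)
      + (?h2 a c (p n) * ?h2 b d (p n) - ?h2 a d (p n) * ?h2 b c (p n))
      = curvature2 h a b c d (p n) - h (\<Gamma> n a c) (\<Gamma> n b d) (p n) + h (\<Gamma> n b c) (\<Gamma> n a d) (p n)"
    by blast
  \<comment> \<open>The slots \<open>a\<close>, \<open>b\<close> come last so that
    \<open>T n c d\<close> is a bilinear form into which the moving directions can be
    inserted.\<close>
  define T where "T n c d a b = \<Omega> (p n) ^ 4 *
      (?h1 a c (p n) * ?h1 b d (p n) - ?h1 a d (p n) * ?h1 b c (p n)
      + (?h2 a c (p n) * ?h2 b d (p n) - ?h2 a d (p n) * ?h2 b c (p n)))" for n a b c d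
  obtain k where "\<forall>a b c d. (\<lambda>n. \<Omega> (p n) ^ 4 * (curvature2 h a b c d (p n)
        - h (\<Gamma> n a c) (\<Gamma> n b d) (p n) + h (\<Gamma> n b c) (\<Gamma> n a d) (p n)))
      \<longlonglongrightarrow> k * (G0 a c * G0 b d - G0 a d * G0 b c)"
    using tendsto_curvature[OF \<Gamma>] by blast
  then have k: "(\<lambda>n. T n c d a b) \<longlonglongrightarrow> k * (G0 a c * G0 b d - G0 a d * G0 b c)" for a b c d
    unfolding T_def by (simp only: curv)
  have T_bil: "bilinear (T n c d)" for n c d
    unfolding bilinear_def T_def
    by (auto intro!: linearI simp: linear_add[OF linY] linear_add[OF linX] linear_scale[OF linY]
        linear_scale[OF linX] B1.add_left B1.scaleR_left B2.add_left B2.scaleR_left algebra_simps)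
  have T0_bil: "bilinear (\<lambda>a b. k * (G0 a c * G0 b d - G0 a d * G0 b c))" for c d
    unfolding bilinear_def
    by (auto intro!: linearI simp: linear_add[OF l0(1)] linear_scale[OF l0(1)] algebra_simps)
  \<comment> \<open>Tangent to the first factor means annihilated by the derivative of
    \<open>X\<close>, and tangent to the second by that of \<open>Y\<close>.\<close>
  have "\<exists>u v v'. ddir X u (p n) = 0 \<and> ddir Y v (p n) = 0 \<and> ddir Y v' (p n) = 0 \<and>
      norm u = 1 \<and> norm v = 1 \<and> norm v' = 1 \<and> v \<bullet> v' = 0" for n
  proof -
    have l: "linear (\<beta>1 (Y (p n)))" "linear (\<beta>2 (X (p n)))"
      by (simp_all add: bounded_linear.linear B1.bounded_linear_right B2.bounded_linear_right)
    have nz: "\<beta>1 (Y (p n)) (Y (p n)) \<noteq> 0" "\<beta>2 (X (p n)) (X (p n)) \<noteq> 0"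
      using Y.unit[OF p] X.unit[OF p] by simp_all
    obtain v v' where "ddir Y v (p n) = 0" "ddir Y v' (p n) = 0" "norm v = 1" "norm v' = 1" "v \<bullet> v' = 0"
      using kernel_orthonormal_pair[OF linY l(1) nz(1) Y.tangent_orthogonal[OF p] dim(2)] by blast
    moreover obtain u where "ddir X u (p n) = 0" "norm u = 1"
      using kernel_orthonormal_pair[OF linX l(2) nz(2) X.tangent_orthogonal[OF p] dim(3)] by blast
    ultimately show ?thesis by blast
  qed
  then obtain u v v' where ker: "\<And>n. ddir X (u n) (p n) = 0" "\<And>n. ddir Y (v n) (p n) = 0"
      "\<And>n. ddir Y (v' n) (p n) = 0" and norm: "\<And>n. norm (u n) = 1" "\<And>n. norm (v n) = 1" "\<And>n. norm (v' n) = 1"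
      and orth: "\<And>n. v n \<bullet> v' n = 0"
    by metis
  \<comment> \<open>The three sequences of directions need a common convergent subsequence, hence
    the product of spheres.\<close>
  have K: "compact (sphere (0::'a) 1 \<times> sphere (0::'a) 1 \<times> sphere (0::'a) 1)"
    by (intro compact_Times compact_sphere)
  have "(u n, v n, v' n) \<in> sphere 0 1 \<times> sphere 0 1 \<times> sphere 0 1" for n using norm by simp
  from K[unfolded compact_def, rule_format, of "\<lambda>n. (u n, v n, v' n)", OF this]
  obtain l r where l: "l \<in> sphere 0 1 \<times> sphere 0 1 \<times> sphere 0 1" and r: "strict_mono r"
      and conv: "((\<lambda>n. (u n, v n, v' n)) \<circ> r) \<longlonglongrightarrow> l"
    by blast
  obtain u0 v0 v0' where l_eq: "l = (u0, v0, v0')" by (cases l)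
  then have lim: "(\<lambda>n. u (r n)) \<longlonglongrightarrow> u0" "(\<lambda>n. v (r n)) \<longlonglongrightarrow> v0" "(\<lambda>n. v' (r n)) \<longlonglongrightarrow> v0'"
    using tendsto_fst[OF conv] tendsto_fst[OF tendsto_snd[OF conv]] tendsto_snd[OF tendsto_snd[OF conv]]
    by (simp_all add: o_def)
  have unit0: "norm u0 = 1" "norm v0 = 1" "norm v0' = 1" using l l_eq by simp_all
  have "(\<lambda>n. v (r n) \<bullet> v' (r n)) \<longlonglongrightarrow> v0 \<bullet> v0'" by (intro tendsto_intros lim)
  then have orth0: "v0 \<bullet> v0' = 0" using orth by (simp add: LIMSEQ_const_iff)
  have T_lim: "(\<lambda>n. T (r n) c d (a n) (b n)) \<longlonglongrightarrow> k * (G0 a0 c * G0 b0 d - G0 a0 d * G0 b0 c)"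
    if "a \<longlonglongrightarrow> a0" "b \<longlonglongrightarrow> b0" for a b a0 b0 c d
    using LIMSEQ_subseq_LIMSEQ[OF k r]
    by (intro tendsto_bilinear_forms[OF T_bil T0_bil _ that]) (simp add: o_def)
  have G_lim': "(\<lambda>n. G (a n) c (p (r n))) \<longlonglongrightarrow> G0 a0 c" if "a \<longlonglongrightarrow> a0" for a a0 c
    using LIMSEQ_subseq_LIMSEQ[OF G_lim(1) r]
    by (intro tendsto_bilinear_forms[OF G_bil[OF p] G0_bil _ that tendsto_const]) (simp add: o_def)
  \<comment> \<open>One argument kills the first form and the other the second, so every product in
    \<open>T\<close> has a vanishing factor.\<close>
  have mixed: "k * (G0 u0 c * G0 w0 d - G0 u0 d * G0 w0 c) = 0"
    if w: "\<And>n. ddir Y (w n) (p n) = 0" "(\<lambda>n. w (r n)) \<longlonglongrightarrow> w0" for w w0 c d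
  proof -
    have "T (r n) c d (u (r n)) (w (r n)) = 0" for n
      by (simp add: T_def ker w(1) B1.zero_left B2.zero_left)
    then show ?thesis using T_lim[OF lim(1) w(2), of c d] by (simp add: LIMSEQ_const_iff)
  qed
  \<comment> \<open>On directions of the second factor the whole metric is \<open>?h2\<close>, so
    the powers of \<Omega> cancel exactly, without error term.\<close>
  have own: "k * (G0 v0 c * G0 v0' d - G0 v0 d * G0 v0' c) = G0 v0 c * G0 v0' d - G0 v0 d * G0 v0' c" for c d
  proof -
    have h2: "?h2 a b (p n) = G a b (p n) / (\<Omega> (p n))\<^sup>2" if "ddir Y a (p n) = 0" for a b n
      using metric[OF p, of a b n] that by (simp add: B1.zero_left)
    have "T (r n) c d (v (r n)) (v' (r n)) = G (v (r n)) c (p (r n)) * G (v' (r n)) d (p (r n))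
        - G (v (r n)) d (p (r n)) * G (v' (r n)) c (p (r n))" for n
      using \<Omega>_pos[OF p, of "r n"]
      by (simp add: T_def h2 ker(2,3) B1.zero_left field_simps eval_nat_numeral)
    moreover have "(\<lambda>n. G (v (r n)) c (p (r n)) * G (v' (r n)) d (p (r n))
        - G (v (r n)) d (p (r n)) * G (v' (r n)) c (p (r n))) \<longlonglongrightarrow> G0 v0 c * G0 v0' d - G0 v0 d * G0 v0' c"
      by (intro tendsto_intros G_lim' lim)
    ultimately have "(\<lambda>n. T (r n) c d (v (r n)) (v' (r n))) \<longlonglongrightarrow> G0 v0 c * G0 v0' d - G0 v0 d * G0 v0' c"
      by (simp only:)
    with T_lim[OF lim(2,3), of c d] show ?thesis by (rule LIMSEQ_unique)
  qed
  have "u0 \<noteq> 0" "v0 \<noteq> 0" using unit0 by auto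
  have "\<not> (\<forall>c d. G0 v0 c * G0 v0' d - G0 v0 d * G0 v0' c = 0)"
  proof
    assume "\<forall>c d. G0 v0 c * G0 v0' d - G0 v0 d * G0 v0' c = 0"
    then obtain s where "v0' = s *\<^sub>R v0"
      using wedge_zero_dependent[OF G0_bil G0_nondeg _ \<open>v0 \<noteq> 0\<close>, of v0'] by blast
    then show False using orth0 unit0 by auto
  qed
  \<comment> \<open>Both evaluations of the limit on \<open>v0\<close>, \<open>v0'\<close> are
    multiples of the same nonzero wedge product, so the factors agree.\<close>
  then have "k = 1" using own by (metis mult_cancel_right1)
  then have wedge: "G0 u0 c * G0 v0 d - G0 u0 d * G0 v0 c = 0" "G0 u0 c * G0 v0' d - G0 u0 d * G0 v0' c = 0" for c d
    using mixed[OF ker(2) lim(2), of c d] mixed[OF ker(3) lim(3), of c d] by simp_all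
  obtain s s' where "v0 = s *\<^sub>R u0" "v0' = s' *\<^sub>R u0"
    using wedge_zero_dependent[OF G0_bil G0_nondeg wedge(1) \<open>u0 \<noteq> 0\<close>]
      wedge_zero_dependent[OF G0_bil G0_nondeg wedge(2) \<open>u0 \<noteq> 0\<close>] by blast
  then show False using orth0 unit0 by auto
qed

section \<open>Charts of the Nariai solution\<close>

lemma smooth_onI:
  assumes "open U" "S \<subseteq> U" "\<And>k. Ck_on k U f"
  shows "smooth_on S f"
  unfolding smooth_on_def using assms by (intro ballI exI[of _ U] exI[of _ f]) auto

lemma smooth_onE:
  assumes "smooth_on S f" "x \<in> S"
  obtains U F where "open U" "x \<in> U" "\<forall>k. Ck_on k U F" "\<forall>y\<in>S \<inter> U. F y = f y"
  using bspec[OF assms(1)[unfolded smooth_on_def] assms(2)] by (elim exE conjE) (rule that)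

lemma smooth_on_subset:
  assumes "smooth_on S f" "T \<subseteq> S"
  shows "smooth_on T f"
  unfolding smooth_on_def
proof
  fix x assume "x \<in> T"
  then have "x \<in> S" using assms(2) by blast
  obtain U F where U: "open U" "x \<in> U" "\<forall>k. Ck_on k U F" "\<forall>y\<in>S \<inter> U. F y = f y"
    by (rule smooth_onE[OF assms(1) \<open>x \<in> S\<close>])
  then show "\<exists>U F. open U \<and> x \<in> U \<and> (\<forall>k. Ck_on k U F) \<and> (\<forall>y\<in>T \<inter> U. F y = f y)"
    using assms(2) by (intro exI[of _ U] exI[of _ F]) auto
qed

lemma smooth_on_imp_Ck_on:
  assumes "smooth_on S f" "open S"
  shows "Ck_on k S f"
proof (rule Ck_on_local)
  fix x assume "x \<in> S"
  from smooth_onE[OF assms(1) this]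
  obtain U F where U: "open U" "x \<in> U" "\<forall>k. Ck_on k U F" "\<forall>y\<in>S \<inter> U. F y = f y"
    by blast
  have "Ck_on k (S \<inter> U) f"
    by (rule Ck_on_cong[OF _ bspec[OF U(4)] Ck_on_subset[OF spec[OF U(3)]]]) (use U(1) assms(2) in auto)
  then show "\<exists>U. open U \<and> x \<in> U \<and> Ck_on k U f"
    using U \<open>x \<in> S\<close> assms(2) by (intro exI[of _ "S \<inter> U"]) auto
qed

lemma smooth_on_compose:
  assumes g: "smooth_on T g" and f: "smooth_on S f" and "f ` S \<subseteq> T"
  shows "smooth_on S (\<lambda>x. g (f x))"
  unfolding smooth_on_def
proof
  fix x assume x: "x \<in> S"
  obtain U F where U: "open U" "x \<in> U" "\<forall>k. Ck_on k U F" "\<forall>y\<in>S \<inter> U. F y = f y"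
    by (rule smooth_onE[OF f x])
  have "f x \<in> T" using x assms(3) by blast
  obtain V E where V: "open V" "f x \<in> V" "\<forall>k. Ck_on k V E" "\<forall>y\<in>T \<inter> V. E y = g y"
    by (rule smooth_onE[OF g \<open>f x \<in> T\<close>])
  have op: "open (U \<inter> F -` V)"
    using U(1) spec[OF U(3), of 0] V(1) by (simp add: continuous_open_preimage)
  have Ck: "Ck_on k (U \<inter> F -` V) (\<lambda>x. E (F x))" for k
    by (rule Ck_on_compose[OF op V(1) _ spec[OF V(3)]]) (auto intro: Ck_on_subset[OF spec[OF U(3)]])
  have "E (F y) = g (f y)" if "y \<in> S \<inter> (U \<inter> F -` V)" for y
    using that bspec[OF U(4), of y] bspec[OF V(4), of "f y"] assms(3) by auto
  moreover have "x \<in> U \<inter> F -` V" using U(2) bspec[OF U(4), of x] V(2) x by auto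
  ultimately show "\<exists>U F. open U \<and> x \<in> U \<and> (\<forall>k. Ck_on k U F) \<and> (\<forall>y\<in>S \<inter> U. F y = g (f y))"
    using op Ck by (intro exI[of _ "U \<inter> F -` V"] exI[of _ "\<lambda>x. E (F x)"]) simp
qed

lemma smooth_on_Pair:
  assumes f: "smooth_on S f" and g: "smooth_on S g"
  shows "smooth_on S (\<lambda>x. (f x, g x))"
  unfolding smooth_on_def
proof
  fix x assume x: "x \<in> S"
  obtain U F where U: "open U" "x \<in> U" "\<forall>k. Ck_on k U F" "\<forall>y\<in>S \<inter> U. F y = f y"
    by (rule smooth_onE[OF f x])
  obtain V E where V: "open V" "x \<in> V" "\<forall>k. Ck_on k V E" "\<forall>y\<in>S \<inter> V. E y = g y"
    by (rule smooth_onE[OF g x])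
  have "Ck_on k (U \<inter> V) (\<lambda>x. (F x, E x))" for k
    using U(1) V(1) by (intro Ck_on_Pair) (auto intro: Ck_on_subset[OF spec[OF U(3)]] Ck_on_subset[OF spec[OF V(3)]])
  then show "\<exists>U F. open U \<and> x \<in> U \<and> (\<forall>k. Ck_on k U F) \<and> (\<forall>y\<in>S \<inter> U. F y = (f y, g y))"
    using U V by (intro exI[of _ "U \<inter> V"] exI[of _ "\<lambda>x. (F x, E x)"]) auto
qed

lemma smooth_on_linear: "linear f \<Longrightarrow> smooth_on S f"
  by (rule smooth_onI[OF open_UNIV subset_UNIV Ck_on_linear[OF open_UNIV]])

text \<open>A chart together with an explicit inverse defined on the whole parameter space. The
  parameter space may be any Euclidean space, so charts of the factors can be multiplied first and
  identified with \<open>real^4\<close> at the end.\<close>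

definition parametrized_patch ::
  "'e::euclidean_space set \<Rightarrow> 'e set \<Rightarrow> ('e \<Rightarrow> 'm::euclidean_space) \<Rightarrow> ('m \<Rightarrow> 'e) \<Rightarrow> bool" where
  "parametrized_patch S U \<phi> \<gamma> \<longleftrightarrow> openin (top_of_set S) U \<and> smooth_on U \<phi> \<and> smooth_on UNIV \<gamma> \<and>
     (\<forall>y. \<gamma> y \<in> U \<and> \<phi> (\<gamma> y) = y) \<and> (\<forall>x\<in>U. \<gamma> (\<phi> x) = x)"

lemma parametrized_patch_UNIV: "parametrized_patch UNIV UNIV (\<lambda>x. x) (\<lambda>x. x)"
  unfolding parametrized_patch_def by (auto intro: smooth_on_linear linear_ident)

lemma parametrized_patch_Times:
  assumes "parametrized_patch S U \<phi> \<gamma>" "parametrized_patch S' U' \<phi>' \<gamma>'"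
  shows "parametrized_patch (S \<times> S') (U \<times> U') (\<lambda>p. (\<phi> (fst p), \<phi>' (snd p))) (\<lambda>p. (\<gamma> (fst p), \<gamma>' (snd p)))"
proof -
  note p = assms[unfolded parametrized_patch_def]
  have "smooth_on (U \<times> U') (\<lambda>p. (\<phi> (fst p), \<phi>' (snd p)))"
  proof (rule smooth_on_Pair)
    show "smooth_on (U \<times> U') (\<lambda>p. \<phi> (fst p))"
      by (rule smooth_on_compose[of U, OF _ smooth_on_linear[OF linear_fst]]) (use p in simp_all)
    show "smooth_on (U \<times> U') (\<lambda>p. \<phi>' (snd p))"
      by (rule smooth_on_compose[of U', OF _ smooth_on_linear[OF linear_snd]]) (use p in simp_all)
  qed
  moreover have "smooth_on UNIV (\<lambda>p. (\<gamma> (fst p), \<gamma>' (snd p)))"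
  proof (rule smooth_on_Pair)
    show "smooth_on UNIV (\<lambda>p. \<gamma> (fst p))"
      by (rule smooth_on_compose[of UNIV, OF _ smooth_on_linear[OF linear_fst]]) (use p in simp_all)
    show "smooth_on UNIV (\<lambda>p. \<gamma>' (snd p))"
      by (rule smooth_on_compose[of UNIV, OF _ smooth_on_linear[OF linear_snd]]) (use p in simp_all)
  qed
  moreover have "openin (top_of_set (S \<times> S')) (U \<times> U')"
    using p by (intro openin_Times) auto
  ultimately show ?thesis using p by (auto simp: parametrized_patch_def)
qed

lemma parametrized_patch_linear:
  assumes "parametrized_patch S U \<phi> \<gamma>" and L: "linear L" "linear L'" "\<And>x. L' (L x) = x" "\<And>x. L (L' x) = x"
  shows "parametrized_patch S U (\<lambda>x. L (\<phi> x)) (\<lambda>y. \<gamma> (L' y))"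
proof -
  note p = assms(1)[unfolded parametrized_patch_def]
  have "smooth_on U (\<lambda>x. L (\<phi> x))"
    by (rule smooth_on_compose[OF smooth_on_linear[OF L(1), of UNIV]]) (use p in auto)
  moreover have "smooth_on UNIV (\<lambda>y. \<gamma> (L' y))"
    by (rule smooth_on_compose[OF _ smooth_on_linear[OF L(2)], of UNIV]) (use p in auto)
  ultimately show ?thesis using p L(3,4) by (simp add: parametrized_patch_def)
qed

lemma parametrized_patch_in_atlas:
  assumes "parametrized_patch S U \<phi> (\<gamma> :: real^'n::finite \<Rightarrow> 'e::euclidean_space)"
  shows "(U, \<phi>) \<in> submanifold_atlas S"
proof -
  have inj: "inj_on \<phi> U"
    using assms unfolding parametrized_patch_def by (metis inj_onI)
  have img: "\<phi> ` U = UNIV" using assms unfolding parametrized_patch_def by (metis surjI image_eqI UNIV_eq_I)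
  have "inv_into U \<phi> = \<gamma>"
    using assms inv_into_f_eq[OF inj] unfolding parametrized_patch_def by (intro ext) metis
  then show ?thesis using assms inj img unfolding submanifold_atlas_def parametrized_patch_def by simp
qed

text \<open>Stereographic projection from the pole \<open>e\<close>, where \<open>j\<close> identifies the parameter space
  with the orthogonal complement of \<open>e\<close> and \<open>j'\<close> is the adjoint of \<open>j\<close>.\<close>

lemma parametrized_patch_sphere:
  fixes j :: "'m::euclidean_space \<Rightarrow> 'e::euclidean_space"
  assumes j: "linear j" "linear j'" "\<And>u. j' (j u) = u" "j' e = 0" "\<And>u. j u \<bullet> e = 0" "\<And>u. norm (j u) = norm u"
    and dec: "\<And>x. x = j (j' x) + (x \<bullet> e) *\<^sub>R e" and e: "norm e = 1"
  shows "parametrized_patch (sphere 0 1) (sphere 0 1 - {e}) (\<lambda>x. (1 / (1 - x \<bullet> e)) *\<^sub>R j' x)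
     (\<lambda>u. (1 / (u \<bullet> u + 1)) *\<^sub>R (2 *\<^sub>R j u + (u \<bullet> u - 1) *\<^sub>R e))"
    (is "parametrized_patch _ ?U ?\<phi> ?\<gamma>")
proof -
  have ee: "e \<bullet> e = 1" using e by (simp add: norm_eq_1)
  have juju: "j u \<bullet> j u = u \<bullet> u" for u using j(6)[of u] by (simp add: norm_eq_sqrt_inner)
  have ej: "e \<bullet> j u = 0" for u using j(5)[of u] by (simp add: inner_commute)
  have pos: "u \<bullet> u + 1 > 0" for u :: 'm using inner_ge_zero[of u] by linarith
  \<comment> \<open>The equality case of the Cauchy-Schwarz inequality for unit vectors is reached
    only at the pole.\<close>
  have U: "x \<bullet> e < 1" if "x \<in> ?U" for x
  proof -
    have "x \<bullet> e \<le> 1" using that e norm_cauchy_schwarz[of x e] by simp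
    moreover have "x \<bullet> e \<noteq> 1"
    proof
      assume "x \<bullet> e = 1"
      have xx: "x \<bullet> x = 1" using that by (simp add: norm_eq_1)
      have "(x - e) \<bullet> (x - e) = 0"
        using xx ee \<open>x \<bullet> e = 1\<close> by (simp add: inner_diff_left inner_diff_right inner_commute)
      then show False using that by simp
    qed
    ultimately show ?thesis by simp
  qed
  have \<gamma>e: "?\<gamma> u \<bullet> e = (u \<bullet> u - 1) / (u \<bullet> u + 1)" for u
    by (simp add: inner_add_left j(5) ee)
  have 1: "?\<gamma> u \<in> ?U \<and> ?\<phi> (?\<gamma> u) = u" for u
  proof -
    have lt: "?\<gamma> u \<bullet> e < 1" unfolding \<gamma>e using pos[of u] by simp
    have "?\<gamma> u \<bullet> ?\<gamma> u = (1 / (u \<bullet> u + 1))\<^sup>2 * (4 * (u \<bullet> u) + (u \<bullet> u - 1)\<^sup>2)"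
      by (simp add: inner_add_left inner_add_right juju ee ej j(5) power2_eq_square add_divide_distrib)
    also have "\<dots> = 1" using pos[of u] by (simp add: power2_eq_square divide_simps) (simp add: algebra_simps)
    finally have "?\<gamma> u \<in> sphere 0 1" by (simp only: mem_sphere_0 norm_eq_1)
    moreover have "?\<gamma> u \<noteq> e"
    proof
      assume "?\<gamma> u = e"
      with lt have "e \<bullet> e < 1" by (simp only:)
      with ee show False by simp
    qed
    moreover have "?\<phi> (?\<gamma> u) = u"
    proof -
      have A: "1 - ?\<gamma> u \<bullet> e = 2 / (u \<bullet> u + 1)"
        unfolding \<gamma>e using pos[of u] by (simp add: field_simps)
      have B: "j' (?\<gamma> u) = (2 / (u \<bullet> u + 1)) *\<^sub>R u"
        by (simp add: linear_scale[OF j(2)] linear_add[OF j(2)] j(3,4))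
      have "1 / (2 / d) * (2 / d) = 1" if "d \<noteq> 0" for d :: real using that by simp
      then have "(1 / (2 / d)) *\<^sub>R ((2 / d) *\<^sub>R u) = u" if "d > 0" for d
        using that by (simp only: scaleR_scaleR scaleR_one)
      from this[OF pos] show ?thesis by (simp only: A B)
    qed
    ultimately show ?thesis by blast
  qed
  have 2: "?\<gamma> (?\<phi> x) = x" if x: "x \<in> ?U" for x
  proof -
    \<comment> \<open>With \<open>s\<close> the height over the equator, Pythagoras gives
      \<open>1 - s\<^sup>2\<close> for the squared norm of \<open>j' x\<close>, hence
      \<open>(1 + s) / (1 - s)\<close> for that of the projected point.\<close>
    define s where "s = x \<bullet> e"
    have s: "1 - s > 0" using U[OF x] by (simp add: s_def)
    have "x \<bullet> x = 1" using x by (simp add: norm_eq_1)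
    moreover have "x \<bullet> x = j' x \<bullet> j' x + s\<^sup>2"
    proof -
      have "x \<bullet> x = (j (j' x) + s *\<^sub>R e) \<bullet> (j (j' x) + s *\<^sub>R e)"
        using dec[of x] by (simp add: s_def)
      also have "\<dots> = j' x \<bullet> j' x + s\<^sup>2"
        by (simp add: inner_add_left inner_add_right juju ee ej j(5) power2_eq_square)
      finally show ?thesis .
    qed
    ultimately have jj: "j' x \<bullet> j' x = (1 - s) * (1 + s)" by (simp add: algebra_simps power2_eq_square)
    define v where "v = (1 / (1 - s)) *\<^sub>R j' x"
    have "v \<bullet> v = 1 / (1 - s) * (1 / (1 - s)) * (j' x \<bullet> j' x)" by (simp add: v_def)
    then have "v \<bullet> v = (1 + s) / (1 - s)" using s jj by simp
    then have v1: "v \<bullet> v + 1 = 2 / (1 - s)" "v \<bullet> v - 1 = 2 * s / (1 - s)"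
      using s by (simp_all add: field_simps)
    have "?\<gamma> v = ((1 - s) / 2) *\<^sub>R ((2 / (1 - s)) *\<^sub>R j (j' x) + (2 * s / (1 - s)) *\<^sub>R e)"
      unfolding v1 by (simp add: v_def linear_scale[OF j(1)])
    also have "\<dots> = j (j' x) + s *\<^sub>R e"
    proof -
      have "(1 - s) / 2 * (2 / (1 - s)) = 1" "(1 - s) / 2 * (2 * s / (1 - s)) = s" using s by simp_all
      then show ?thesis by (simp only: scaleR_add_right scaleR_scaleR scaleR_one)
    qed
    finally show ?thesis using dec[of x] by (simp add: s_def v_def)
  qed
  have 3: "openin (top_of_set (sphere 0 1)) ?U"
    unfolding Diff_eq by (rule openin_open_Int) (simp add: open_Compl)
  have 4: "smooth_on ?U ?\<phi>"
  proof (rule smooth_onI)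
    show op: "open {x. x \<bullet> e < 1}" using open_halfspace_lt[of e 1] by (simp add: inner_commute)
    have "linear (\<lambda>x. x \<bullet> (- e))" by (rule bounded_linear.linear[OF bounded_linear_inner_left])
    from Ck_on_add[OF op Ck_on_const[OF op] Ck_on_linear[OF op this], of _ 1]
    have "Ck_on k {x. x \<bullet> e < 1} (\<lambda>x. 1 - x \<bullet> e)" for k by simp
    from Ck_on_scaleR[OF op Ck_on_divide[OF op _ Ck_on_const[OF op] this] Ck_on_linear[OF op j(2)]]
    show "Ck_on k {x. x \<bullet> e < 1} ?\<phi>" for k by simp
  qed (use U in auto)
  have 5: "smooth_on UNIV ?\<gamma>"
  proof (rule smooth_onI[OF open_UNIV subset_UNIV])
    note const = Ck_on_const[OF open_UNIV] and scale = Ck_on_scaleR[OF open_UNIV]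
    have Ck: "Ck_on k UNIV (\<lambda>u::'m. u \<bullet> u + c)" for k c
      by (rule Ck_on_add[OF open_UNIV Ck_on_inner[OF open_UNIV Ck_on_linear Ck_on_linear] const])
        (simp_all add: linear_ident)
    have A: "Ck_on k UNIV (\<lambda>u::'m. 1 / (u \<bullet> u + 1))" for k
      by (rule Ck_on_divide[OF open_UNIV _ const Ck]) (use pos in \<open>simp add: less_imp_neq[symmetric]\<close>)
    have B: "Ck_on k UNIV (\<lambda>u::'m. 2 *\<^sub>R j u + (u \<bullet> u + (- 1)) *\<^sub>R e)" for k
      by (rule Ck_on_add[OF open_UNIV scale[OF const Ck_on_linear[OF open_UNIV j(1)]] scale[OF Ck const]])
    show "Ck_on k UNIV ?\<gamma>" for k
      using scale[OF A B] by (simp only: diff_conv_add_uminus)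
  qed
  show ?thesis unfolding parametrized_patch_def using 1 by (intro conjI 2 3 4 5 allI ballI) blast+
qed

section \<open>Patches covering the circle, the sphere and the Nariai space\<close>

lemma circle_patches:
  assumes "z \<in> sphere (0::complex) 1"
  shows "\<exists>U (\<phi> :: complex \<Rightarrow> real) \<gamma>. parametrized_patch (sphere 0 1) U \<phi> \<gamma> \<and> z \<in> U"
proof -
  \<comment> \<open>Any pole other than \<open>z\<close> works; both candidates are orthogonal to
    the real axis, which serves as parameter space.\<close>
  define e where "e = (if z = \<i> then - \<i> else \<i>)"
  have "z \<in> sphere 0 1 - {e}" using assms by (auto simp: e_def)
  moreover have "parametrized_patch (sphere 0 1) (sphere 0 1 - {e}) (\<lambda>x. (1 / (1 - x \<bullet> e)) *\<^sub>R Re x)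
     (\<lambda>u. (1 / (u \<bullet> u + 1)) *\<^sub>R (2 *\<^sub>R complex_of_real u + (u \<bullet> u - 1) *\<^sub>R e))"
    by (rule parametrized_patch_sphere)
       (auto simp: e_def complex_eq_iff inner_complex_def intro!: linearI)
  ultimately show ?thesis by blast
qed

lemma sphere3_patches:
  assumes "x \<in> sphere (0::real^3) 1"
  shows "\<exists>U (\<phi> :: real^3 \<Rightarrow> real \<times> real) \<gamma>. parametrized_patch (sphere 0 1) U \<phi> \<gamma> \<and> x \<in> U"
proof -
  \<comment> \<open>The sign puts the pole on the third axis, away from \<open>x\<close>.\<close>
  define s :: real where "s = (if x = axis 3 1 then - 1 else 1)"
  define e :: "real^3" where "e = axis 3 s"
  have s: "s * s = 1" "\<bar>s\<bar> = 1" by (simp_all add: s_def)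
  have e: "e $ 1 = 0" "e $ 2 = 0" "e $ 3 = s" by (simp_all add: e_def axis_def)
  have "x \<noteq> e" by (auto simp: e_def s_def axis_eq_axis)
  then have "x \<in> sphere 0 1 - {e}" using assms by simp
  moreover have "parametrized_patch (sphere 0 1) (sphere 0 1 - {e}) (\<lambda>x. (1 / (1 - x \<bullet> e)) *\<^sub>R (x $ 1, x $ 2))
     (\<lambda>u. (1 / (u \<bullet> u + 1)) *\<^sub>R (2 *\<^sub>R (vector [fst u, snd u, 0] :: real^3) + (u \<bullet> u - 1) *\<^sub>R e))"
  proof (rule parametrized_patch_sphere)
    show "norm (vector [fst u, snd u, 0] :: real^3) = norm u" for u :: "real \<times> real"
      by (simp add: norm_vec_def L2_set_def sum_3 norm_prod_def)
    show "y = (vector [fst (y $ 1, y $ 2), snd (y $ 1, y $ 2), 0] :: real^3) + (y \<bullet> e) *\<^sub>R e" for y :: "real^3"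
      using s by (simp add: vec_eq_iff forall_3 inner_vec_def sum_3 e)
    show "norm e = 1" using s by (simp add: norm_vec_def L2_set_def sum_3 e)
  qed (auto simp: vec_eq_iff forall_3 inner_vec_def sum_3 e zero_prod_def intro!: linearI)
  ultimately show ?thesis by blast
qed

lemma vector_4:
  "(vector [a, b, c, d] :: 'a::zero^4) $ 1 = a" "(vector [a, b, c, d] :: 'a^4) $ 2 = b"
  "(vector [a, b, c, d] :: 'a^4) $ 3 = c" "(vector [a, b, c, d] :: 'a^4) $ 4 = d"
  unfolding vector_def by simp_all

text \<open>The atlas consists of whatever charts exist. Without enough of them the conditions on
  \<open>\<iota>\<close>, which quantify over charts, would say nothing near some points.\<close>

lemma nariai_atlas_covers:
  fixes C :: "'r::euclidean_space set"
  assumes "\<And>z. z \<in> C \<Longrightarrow> \<exists>U (\<phi> :: 'r \<Rightarrow> real) \<gamma>. parametrized_patch C U \<phi> \<gamma> \<and> z \<in> U"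
    and "p \<in> nariai_space C"
  shows "\<exists>U \<phi>. (U, \<phi>) \<in> nariai_atlas C \<and> p \<in> U"
proof -
  obtain t z x where p: "p = (t, z, x)" "z \<in> C" "x \<in> sphere 0 1"
    using assms(2) unfolding nariai_space_def by auto
  obtain U1 and \<phi>1 :: "'r \<Rightarrow> real" and \<gamma>1 where 1: "parametrized_patch C U1 \<phi>1 \<gamma>1" "z \<in> U1"
    using assms(1)[OF p(2)] by blast
  obtain U2 and \<phi>2 :: "real^3 \<Rightarrow> real \<times> real" and \<gamma>2 where 2: "parametrized_patch (sphere 0 1) U2 \<phi>2 \<gamma>2" "x \<in> U2"
    using sphere3_patches[OF p(3)] by blast
  let ?L = "\<lambda>(t, z, (a, b)). vector [t, z, a, b] :: real^4" and ?L' = "\<lambda>v::real^4. (v $ 1, v $ 2, (v $ 3, v $ 4))"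
  note pp = parametrized_patch_Times[OF parametrized_patch_UNIV parametrized_patch_Times[OF 1(1) 2(1)]]
  have L: "linear ?L" "linear ?L'" "?L' (?L w) = w" "?L (?L' v) = v" for w v
    by (auto intro!: linearI simp: vec_eq_iff forall_4 vector_4 split: prod.split)
  have "(UNIV \<times> U1 \<times> U2, \<lambda>x. ?L (fst x, \<phi>1 (fst (snd x)), \<phi>2 (snd (snd x)))) \<in> nariai_atlas C"
    unfolding nariai_atlas_def nariai_space_def
    using parametrized_patch_in_atlas[OF parametrized_patch_linear[OF pp L]] by simp
  then show ?thesis using p 1 2
    by (intro exI[of _ "UNIV \<times> U1 \<times> U2"] exI conjI) auto
qed

section \<open>Conformal extensions in a boundary chart\<close>

lemma smooth_on_differentiable_within:
  assumes "smooth_on S f" "x \<in> S"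
  shows "f differentiable (at x within S)"
proof -
  obtain U F where U: "open U" "x \<in> U" "\<forall>k. Ck_on k U F" "\<forall>y\<in>S \<inter> U. F y = f y"
    by (rule smooth_onE[OF assms])
  have "(F has_derivative (\<lambda>v. ddir F v x)) (at x within S)"
    by (rule has_derivative_at_withinI[OF Ck_on_SucD[OF spec[OF U(3)] U(2)]])
  moreover have "\<forall>\<^sub>F y in at x within S. F y = f y"
    using U(1,2,4) by (auto simp: eventually_at_topological)
  ultimately have "(f has_derivative (\<lambda>v. ddir F v x)) (at x within S)"
    using U(2,4) assms(2) by (intro has_derivative_transform_eventually[of F _ x S f]) auto
  then show ?thesis by (rule differentiableI)
qed

text \<open>Near \<open>q\<close> the map has a smooth extension to a full neighbourhood. On the
  open set \<open>W\<close> the extension has the same derivatives, so their limits are the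
  derivatives of the extension at \<open>q\<close>. This provides the hypotheses of
  \<open>conformal_asymptotics\<close>.\<close>

lemma smooth_on_limits:
  fixes f :: "'a::euclidean_space \<Rightarrow> 'b::euclidean_space"
  assumes f: "smooth_on S f" and q: "q \<in> S" and W: "W \<subseteq> S" "open W" and p: "\<And>n. p n \<in> W" "p \<longlonglongrightarrow> q"
  shows "(\<lambda>n. f (p n)) \<longlonglongrightarrow> f q"
    and "\<exists>D. linear D \<and> (\<forall>v. (\<lambda>n. ddir f v (p n)) \<longlonglongrightarrow> D v)"
    and "\<exists>l. (\<lambda>n. ddir (ddir f v) w (p n)) \<longlonglongrightarrow> l"
proof -
  obtain U F where U: "open U" "q \<in> U" "\<forall>k. Ck_on k U F" "\<forall>y\<in>S \<inter> U. F y = f y"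
    by (rule smooth_onE[OF f q])
  have op: "open (W \<inter> U)" using W U by blast
  have eq0: "F y = f y" if "y \<in> W \<inter> U" for y using that U(4) W by blast
  have eq1: "ddir F v y = ddir f v y" if "y \<in> W \<inter> U" for v y
    using frechet_derivative_cong_open[OF op that eq0] by simp
  have eq2: "ddir (ddir F v) w y = ddir (ddir f v) w y" if "y \<in> W \<inter> U" for v w y
    using frechet_derivative_cong_open[OF op that eq1] by simp
  have ev: "\<forall>\<^sub>F n in sequentially. p n \<in> W \<inter> U"
    using topological_tendstoD[OF p(2) U(1,2)] p(1) by simp
  have lim: "(\<lambda>n. g (p n)) \<longlonglongrightarrow> h q"
    if "continuous_on U h" "\<And>y. y \<in> W \<inter> U \<Longrightarrow> h y = g y" for g h :: "'a \<Rightarrow> 'b"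
  proof -
    have "isCont h q" using that(1) U(1,2) by (simp add: continuous_on_eq_continuous_at)
    then have "(\<lambda>n. h (p n)) \<longlonglongrightarrow> h q" using p(2) by (rule isCont_tendsto_compose)
    then show ?thesis
      by (rule Lim_transform_eventually) (use ev that(2) in \<open>auto elim: eventually_mono\<close>)
  qed
  have C2: "Ck_on (Suc (Suc 0)) U F" using U(3) by blast
  then have C1: "Ck_on (Suc 0) U F" by (rule Ck_on_Suc_imp)
  have "f q = F q" using U(2,4) q by simp
  then show "(\<lambda>n. f (p n)) \<longlonglongrightarrow> f q"
    using lim[OF Ck_on_imp_continuous_on[OF C1] eq0] by simp
  have "(\<lambda>n. ddir f v (p n)) \<longlonglongrightarrow> ddir F v q" for v
    by (rule lim[OF _ eq1]) (use C1 in simp_all)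
  moreover have "linear (\<lambda>v. ddir F v q)" by (rule linear_ddir[OF C1 U(2)])
  ultimately show "\<exists>D. linear D \<and> (\<forall>v. (\<lambda>n. ddir f v (p n)) \<longlonglongrightarrow> D v)"
    by (intro exI[of _ "\<lambda>v. ddir F v q"]) blast
  have "(\<lambda>n. ddir (ddir f v) w (p n)) \<longlonglongrightarrow> ddir (ddir F v) w q"
    by (rule lim[OF _ eq2]) (use C2 in simp_all)
  then show "\<exists>l. (\<lambda>n. ddir (ddir f v) w (p n)) \<longlonglongrightarrow> l" by blast
qed

text \<open>One chart of the extension is fixed, and \<open>W\<close> is the interior part of its
  image. The map \<open>F\<close> reads the inverse of \<open>\<iota>\<close> in this chart as a map
  into the ambient Euclidean space, where it can be composed with functions such as
  \<open>sinh\<close> without choosing charts of \<open>S\<close>.\<close>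

locale submanifold_extension =
  fixes S :: "'e::euclidean_space set" and H :: "'e \<Rightarrow> 'e \<Rightarrow> 'e \<Rightarrow> real"
    and X' :: "'b topology" and A' :: "('b, 'n::{finite,one}) chart set"
    and \<iota> :: "'e \<Rightarrow> 'b" and g' \<Omega> V \<psi>
  assumes ext: "smooth_conformal_extension (top_of_set S) (submanifold_atlas S) (induced_tensor H) X' A' \<iota> g' \<Omega>"
    and cover: "\<And>p. p \<in> S \<Longrightarrow> \<exists>U \<phi>. (U, \<phi> :: 'e \<Rightarrow> (real, 'n::{finite,one}) vec) \<in> submanifold_atlas S \<and> p \<in> U"
    and V: "(V, \<psi>) \<in> A'"
begin

abbreviation "AS \<equiv> submanifold_atlas S :: ('e, 'n) chart set"
abbreviation "M' \<equiv> mfd_interior A'"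
abbreviation "\<sigma> \<equiv> inv_into V \<psi>"
definition "W = \<psi> ` V \<inter> interior half_space"
definition "F x = inv_into S \<iota> (\<sigma> x)"

lemma ext_parts:
  "smooth_manifold half_space X' A'"
  "diffeomorphism (top_of_set S) (AS) (subtopology X' M') (restrict_atlas A' M') \<iota>"
  "lorentzian_metric A' g'" "smooth_function A' \<Omega>" "\<forall>q\<in>M'. \<Omega> q > 0" "\<forall>q\<in>mfd_boundary A'. \<Omega> q = 0"
  "\<forall>(U, \<phi>)\<in>AS. \<forall>(V, \<psi>)\<in>A'. \<forall>p\<in>U. \<iota> p \<in> V \<longrightarrow>
     (let D = frechet_derivative (\<psi> \<circ> \<iota> \<circ> inv_into U \<phi>) (at (\<phi> p) within \<phi> ` (U \<inter> \<iota> -` V))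
      in \<forall>u v. induced_tensor H (U, \<phi>) p u v = g' (V, \<psi>) (\<iota> p) (D u) (D v) / (\<Omega> (\<iota> p))\<^sup>2)"
proof -
  note parts = ext[unfolded smooth_conformal_extension_def]
  show "smooth_manifold half_space X' A'"
    using parts by (elim conjE)
  show "diffeomorphism (top_of_set S) (AS) (subtopology X' M') (restrict_atlas A' M') \<iota>"
    using parts by (elim conjE)
  show "lorentzian_metric A' g'"
    using parts by (elim conjE)
  show "smooth_function A' \<Omega>"
    using parts by (elim conjE)
  show "\<forall>q\<in>M'. \<Omega> q > 0"
    using parts by (elim conjE)
  show "\<forall>q\<in>mfd_boundary A'. \<Omega> q = 0"
    using parts by (elim conjE)
  show "\<forall>(U, \<phi>)\<in>AS. \<forall>(V, \<psi>)\<in>A'. \<forall>p\<in>U. \<iota> p \<in> V \<longrightarrow>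
     (let D = frechet_derivative (\<psi> \<circ> \<iota> \<circ> inv_into U \<phi>) (at (\<phi> p) within \<phi> ` (U \<inter> \<iota> -` V))
      in \<forall>u v. induced_tensor H (U, \<phi>) p u v = g' (V, \<psi>) (\<iota> p) (D u) (D v) / (\<Omega> (\<iota> p))\<^sup>2)"
    using parts by (elim conjE)
qed

lemma chart: "openin X' V" "openin (top_of_set half_space) (\<psi> ` V)"
    "homeomorphic_map (subtopology X' V) (top_of_set (\<psi> ` V)) \<psi>"
proof -
  have "is_chart half_space X' (V, \<psi>)"
    using ext_parts(1) V unfolding smooth_manifold_def by (elim conjE) (rule bspec)
  then show "openin X' V" "openin (top_of_set half_space) (\<psi> ` V)"
    "homeomorphic_map (subtopology X' V) (top_of_set (\<psi> ` V)) \<psi>"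
    by (auto simp: is_chart_def)
qed

lemma V_subset: "V \<subseteq> topspace X'" using chart(1) by (rule openin_subset)

lemma inj_\<psi>: "inj_on \<psi> V"
  using chart(3) V_subset by (simp add: homeomorphic_map_def Int_absorb1 topspace_subtopology)

lemma open_W: "open W"
proof -
  obtain T where "open T" "\<psi> ` V = half_space \<inter> T" using chart(2) by (auto simp: openin_open)
  moreover have "half_space \<inter> T \<inter> interior half_space = T \<inter> interior half_space" for T :: "(real, 'n) vec set"
    using interior_subset by blast
  ultimately show ?thesis by (simp add: W_def open_Int)
qed

lemma \<sigma>_W: "x \<in> W \<Longrightarrow> \<sigma> x \<in> V" "x \<in> W \<Longrightarrow> \<psi> (\<sigma> x) = x" "x \<in> W \<Longrightarrow> \<sigma> x \<in> M'"
proof -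
  assume x: "x \<in> W"
  show 1: "\<sigma> x \<in> V" and 2: "\<psi> (\<sigma> x) = x" using x by (auto simp: W_def inv_into_into f_inv_into_f)
  have "\<psi> (\<sigma> x) \<in> interior half_space" unfolding 2 using x by (simp add: W_def)
  then show "\<sigma> x \<in> M'" unfolding mfd_interior_def using 1 by (intro CollectI bexI[OF _ V]) simp
qed

lemma continuous_\<sigma>: "continuous_map (top_of_set W) (subtopology X' M') \<sigma>"
proof -
  obtain k where k: "homeomorphic_maps (subtopology X' V) (top_of_set (\<psi> ` V)) \<psi> k"
    using chart(3) homeomorphic_map_maps by blast
  then have k1: "continuous_map (top_of_set (\<psi> ` V)) (subtopology X' V) k" and k2: "\<And>v. v \<in> V \<Longrightarrow> k (\<psi> v) = v"
    using V_subset by (auto simp: homeomorphic_maps_def topspace_subtopology)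
  have k\<sigma>: "k x = \<sigma> x" if "x \<in> W" for x using k2[OF \<sigma>_W(1)[OF that]] \<sigma>_W(2)[OF that] by simp
  have "continuous_map (top_of_set W) X' k"
    using continuous_map_from_subtopology_mono[OF continuous_map_in_subtopology[THEN iffD1, OF k1, THEN conjunct1], of W]
    by (simp add: W_def)
  then have "continuous_map (top_of_set W) X' \<sigma>"
    by (rule continuous_map_eq) (simp add: k\<sigma>)
  then show ?thesis using \<sigma>_W(3) by (auto simp: continuous_map_in_subtopology)
qed

lemma diffeo:
  "bij_betw \<iota> S (topspace X' \<inter> M')"
  "smooth_map (top_of_set S) (AS) (subtopology X' M') (restrict_atlas A' M') \<iota>"
  "smooth_map (subtopology X' M') (restrict_atlas A' M') (top_of_set S) (AS) (inv_into S \<iota>)"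
proof -
  note parts = ext_parts(2)[unfolded diffeomorphism_def topspace_euclidean_subtopology topspace_subtopology topspace_euclidean Int_UNIV_left]
  show "bij_betw \<iota> S (topspace X' \<inter> M')" using parts by (elim conjE)
  show "smooth_map (top_of_set S) (AS) (subtopology X' M') (restrict_atlas A' M') \<iota>"
    using parts by (elim conjE)
  show "smooth_map (subtopology X' M') (restrict_atlas A' M') (top_of_set S) (AS) (inv_into S \<iota>)"
    using parts by (elim conjE)
qed

lemma \<iota>_F: "x \<in> W \<Longrightarrow> \<iota> (F x) = \<sigma> x"
proof -
  assume x: "x \<in> W"
  have "\<sigma> x \<in> \<iota> ` S" using diffeo(1) \<sigma>_W(1,3)[OF x] V_subset by (auto simp: bij_betw_def)
  then show ?thesis unfolding F_def by (rule f_inv_into_f)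
qed

lemma F_continuous: "continuous_on W F" "x \<in> W \<Longrightarrow> F x \<in> S"
proof -
  have "continuous_map (top_of_set W) (top_of_set S) (inv_into S \<iota> \<circ> \<sigma>)"
    using diffeo(3)[unfolded smooth_map_def, THEN conjunct1] by (rule continuous_map_compose[OF continuous_\<sigma>])
  moreover have "inv_into S \<iota> \<circ> \<sigma> = F" by (simp add: F_def fun_eq_iff)
  ultimately have "continuous_on W F \<and> F \<in> W \<rightarrow> S"
    by (simp only: continuous_map_subtopology_eu)
  then show "continuous_on W F" "x \<in> W \<Longrightarrow> F x \<in> S" by blast+
qed

lemma V_restrict: "(V \<inter> M', \<psi>) \<in> restrict_atlas A' M'"
  using V unfolding restrict_atlas_def by force

text \<open>Continuity of \<open>F\<close> keeps a neighbourhood of \<open>x\<close> inside one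
  chart domain of \<open>S\<close>, where smoothness of the inverse of \<open>\<iota>\<close> can be
  read off.\<close>

lemma local_chart:
  assumes x: "x \<in> W"
  obtains U \<phi> D where "(U, \<phi>) \<in> AS" "open D" "x \<in> D" "D \<subseteq> W" "F ` D \<subseteq> U"
    "\<forall>k. Ck_on k D (\<lambda>y. \<phi> (F y) :: (real, 'n) vec)"
proof -
  obtain U and \<phi> :: "'e \<Rightarrow> (real, 'n) vec" where U: "(U, \<phi>) \<in> AS" "F x \<in> U"
    using cover F_continuous(2)[OF x] by blast
  then obtain T where T: "open T" "U = S \<inter> T" by (auto simp: submanifold_atlas_def openin_open)
  define D where "D = W \<inter> F -` T"
  have D: "open D" "x \<in> D" "D \<subseteq> W" "F ` D \<subseteq> U"
    using continuous_open_preimage[OF F_continuous(1) open_W T(1)] U(2) x F_continuous(2)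
    by (auto simp: D_def T(2))
  \<comment> \<open>The diffeomorphism refers to the chart restricted to the interior, whose
    \<open>inv_into\<close> is a different term; injectivity identifies the two on
    \<open>W\<close>.\<close>
  have \<sigma>': "inv_into (V \<inter> M') \<psi> y = \<sigma> y" if "y \<in> W" for y
    using inv_into_f_f[of \<psi> "V \<inter> M'" "\<sigma> y"] \<sigma>_W[OF that] inj_\<psi> by (simp add: inj_on_Int)
  have sm: "smooth_on (\<psi> ` (V \<inter> M' \<inter> inv_into S \<iota> -` U)) (\<phi> \<circ> inv_into S \<iota> \<circ> inv_into (V \<inter> M') \<psi>)"
    using diffeo(3)[unfolded smooth_map_def, THEN conjunct2, THEN bspec, OF V_restrict,
        unfolded prod.case, THEN bspec, OF U(1)] by (simp only: prod.case)
  have "D \<subseteq> \<psi> ` (V \<inter> M' \<inter> inv_into S \<iota> -` U)"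
  proof
    fix y assume y: "y \<in> D"
    then have "y \<in> W" "F y \<in> U" using D by auto
    then have "\<sigma> y \<in> V \<inter> M' \<inter> inv_into S \<iota> -` U" using \<sigma>_W by (simp add: F_def)
    then show "y \<in> \<psi> ` (V \<inter> M' \<inter> inv_into S \<iota> -` U)" using \<sigma>_W(2)[OF \<open>y \<in> W\<close>] by (metis imageI)
  qed
  from smooth_on_imp_Ck_on[OF smooth_on_subset[OF sm this] D(1)]
  have "Ck_on k D (\<phi> \<circ> inv_into S \<iota> \<circ> inv_into (V \<inter> M') \<psi>)" for k .
  then have "Ck_on k D (\<lambda>y. \<phi> (F y))" for k
    by (rule Ck_on_cong[OF D(1), rotated]) (use D(3) in \<open>auto simp: F_def \<sigma>'\<close>)
  then show ?thesis using that U(1) D by blast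
qed

lemma atlas_inverse:
  assumes "(U, \<phi> :: 'e \<Rightarrow> (real, 'n) vec) \<in> AS"
  shows "open (\<phi> ` U)" "\<And>p. p \<in> U \<Longrightarrow> inv_into U \<phi> (\<phi> p) = p" "\<And>k. Ck_on k (\<phi> ` U) (inv_into U \<phi>)"
proof -
  note parts = assms[unfolded submanifold_atlas_def, simplified]
  show op: "open (\<phi> ` U)" using parts by blast
  show "inv_into U \<phi> (\<phi> p) = p" if "p \<in> U" for p using parts that inv_into_f_f by metis
  show "Ck_on k (\<phi> ` U) (inv_into U \<phi>)" for k using parts by (intro smooth_on_imp_Ck_on op) blast
qed

lemma F_Ck: "Ck_on k W F"
proof (rule Ck_on_local)
  fix x assume "x \<in> W"
  then obtain U \<phi> D where U: "(U, \<phi>) \<in> AS" and D: "open D" "x \<in> D" "D \<subseteq> W" "F ` D \<subseteq> U"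
      and Ck: "\<forall>k. Ck_on k D (\<lambda>y. \<phi> (F y) :: (real, 'n) vec)"
    by (rule local_chart)
  have "Ck_on k D (\<lambda>y. inv_into U \<phi> (\<phi> (F y)))"
    by (rule Ck_on_compose[OF D(1) atlas_inverse(1)[OF U] _ atlas_inverse(3)[OF U] spec[OF Ck]]) (use D(4) in auto)
  then have "Ck_on k D F"
    by (rule Ck_on_cong[OF D(1), rotated]) (use atlas_inverse(2)[OF U] D(4) in auto)
  then show "\<exists>U. open U \<and> x \<in> U \<and> Ck_on k U F" using D by blast
qed

text \<open>The extension compares the metrics through charts of \<open>S\<close>. As
  \<open>?J \<circ> ?K\<close> is the identity near \<open>x\<close>, inserting the vectors
  \<open>?K' u\<close> and \<open>?K' v\<close> removes the derivative of \<open>?J\<close>, and the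
  chain rule turns the induced tensor into the ambient form on derivatives of
  \<open>F\<close>.\<close>

lemma F_pullback:
  assumes x: "x \<in> W"
  shows "H (F x) (ddir F u x) (ddir F v x) = g' (V, \<psi>) (\<sigma> x) u v / (\<Omega> (\<sigma> x))\<^sup>2"
proof -
  obtain U \<phi> D where U: "(U, \<phi>) \<in> AS" and D: "open D" "x \<in> D" "D \<subseteq> W" "F ` D \<subseteq> U"
      and Ck: "\<forall>k. Ck_on k D (\<lambda>y. \<phi> (F y) :: (real, 'n) vec)"
    using x by (rule local_chart)
  let ?E = "inv_into U \<phi>" and ?K = "\<lambda>y. \<phi> (F y)"
  let ?J = "\<psi> \<circ> \<iota> \<circ> ?E" and ?O = "\<phi> ` (U \<inter> \<iota> -` V)"
  let ?E' = "frechet_derivative ?E (at (?K x))" and ?K' = "frechet_derivative ?K (at x)"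
  let ?J' = "frechet_derivative ?J (at (?K x) within ?O)"
  have FU: "F x \<in> U" using D by blast
  have UO: "U \<inter> \<iota> -` V = U \<inter> \<iota> -` (V \<inter> M')"
  proof -
    have "U \<subseteq> S" using U openin_subset unfolding submanifold_atlas_def by fastforce
    then show ?thesis using diffeo(1) by (auto simp: bij_betw_def)
  qed
  have K: "(?K has_derivative ?K') (at x)"
    using Ck_on_SucD[OF spec[OF Ck] D(2)] by simp
  have E: "(?E has_derivative ?E') (at (?K x))"
    using Ck_on_SucD[OF atlas_inverse(3)[OF U]] FU by simp
  have "smooth_on ?O ?J"
    unfolding UO using diffeo(2)[unfolded smooth_map_def, THEN conjunct2, THEN bspec, OF U,
        unfolded prod.case, THEN bspec, OF V_restrict] by (simp only: prod.case)
  moreover have KO: "?K ` D \<subseteq> ?O"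
    using D(3,4) \<iota>_F \<sigma>_W(1) by fastforce
  ultimately have "?J differentiable (at (?K x) within ?O)"
    using D(2) by (intro smooth_on_differentiable_within) auto
  then have "(?J has_derivative ?J') (at (?K x) within ?K ` D)"
    using KO by (auto simp: frechet_derivative_works intro: has_derivative_subset)
  from diff_chain_within[OF has_derivative_at_withinI[OF K] this]
  have hJK: "(?J \<circ> ?K has_derivative ?J' \<circ> ?K') (at x)"
    by (simp only: at_within_open[OF D(2,1)])
  have eqJK: "(?J \<circ> ?K) y = y" if "y \<in> D" for y
    using that D(3,4) atlas_inverse(2)[OF U] \<iota>_F \<sigma>_W(2) by (auto simp: subset_iff)
  \<comment> \<open>The derivative \<open>?J'\<close> is taken within a set; composed with
    \<open>?K'\<close> it is a derivative at a point of an open set, where derivatives are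
    unique.\<close>
  have id: "((\<lambda>y. y) has_derivative ?J' \<circ> ?K') (at x)"
    by (rule has_derivative_transform_within_open[OF hJK D(1,2) eqJK])
  then have JK: "?J' (?K' w) = w" for w
    using fun_cong[OF has_derivative_unique[OF id has_derivative_ident], of w] by simp
  have "(?E \<circ> ?K has_derivative ?E' \<circ> ?K') (at x)" by (rule diff_chain_at[OF K E])
  then have "(F has_derivative ?E' \<circ> ?K') (at x)"
    by (rule has_derivative_transform_within_open[OF _ D(1,2)]) (use D(4) atlas_inverse(2)[OF U] in auto)
  then have FEK: "ddir F w x = ?E' (?K' w)" for w by (simp add: ddir_eqI)
  have "\<forall>p\<in>U. \<iota> p \<in> V \<longrightarrow>
        (let D = frechet_derivative ?J (at (\<phi> p) within ?O)
         in \<forall>u v. induced_tensor H (U, \<phi>) p u v = g' (V, \<psi>) (\<iota> p) (D u) (D v) / (\<Omega> (\<iota> p))\<^sup>2)"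
    using ext_parts(7)[THEN bspec, OF U, unfolded prod.case, THEN bspec, OF V] by (simp only: prod.case)
  from this[rule_format, OF FU]
  have "induced_tensor H (U, \<phi>) (F x) u v = g' (V, \<psi>) (\<sigma> x) (?J' u) (?J' v) / (\<Omega> (\<sigma> x))\<^sup>2" for u v
    using \<sigma>_W(1)[OF x] by (simp add: \<iota>_F[OF x] Let_def)
  from this[of "?K' u" "?K' v"] show ?thesis
    unfolding JK FEK by (simp add: induced_tensor_def Let_def)
qed

end

section \<open>The Nariai solution\<close>

lemma half_space_interior: "interior half_space = {x :: real^'n::{finite,one}. 0 < x $ 1}"
  using interior_halfspace_component_ge[of 0 "1::'n"] by (simp add: half_space_def)

lemma half_space_frontier:
  fixes x :: "real^'n::{finite,one}"
  assumes x: "x \<in> frontier half_space"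
  shows "x $ 1 = 0"
proof -
  have "closed (half_space :: (real, 'n) vec set)"
    unfolding half_space_def using closed_halfspace_component_ge_cart[of 0 "1::'n"] by simp
  then have "x \<in> half_space" using x by (simp add: frontier_def)
  moreover have "x \<notin> interior half_space" using x by (simp add: frontier_def)
  ultimately show ?thesis unfolding half_space_interior by (simp add: half_space_def)
qed

text \<open>Three-dimensional Minkowski space with time in the first component; its vectors of
  square 1 form two-dimensional de Sitter space.\<close>

definition minkowski :: "real \<times> complex \<Rightarrow> real \<times> complex \<Rightarrow> real" where
  "minkowski a b = snd a \<bullet> snd b - fst a * fst b"

lemma bounded_bilinear_minkowski: "bounded_bilinear minkowski"
proof -
  have "bilinear minkowski"
    unfolding bilinear_def minkowski_def
    by (auto intro!: linearI simp: inner_add_left inner_add_right algebra_simps)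
  then show ?thesis by (simp add: bilinear_conv_bounded_bilinear)
qed

lemma unit_immersion_inner:
  assumes "open W" "Ck_on 3 W f" "\<And>x. x \<in> W \<Longrightarrow> norm (f x) = 1"
  shows "unit_immersion W inner f"
proof (rule unit_immersion.intro)
  show "f x \<bullet> f x = 1" if "x \<in> W" for x using assms(3)[OF that] by (simp add: norm_eq_1)
  show "y \<bullet> z = z \<bullet> y" for y z :: 'b by (rule inner_commute)
qed (rule assms bounded_bilinear_inner)+

lemma (in submanifold_extension) boundary_sequence:
  assumes "q \<in> V" "\<psi> q \<in> frontier half_space"
  obtains p where "\<And>n. p n \<in> W" "p \<longlonglongrightarrow> \<psi> q"
proof -
  obtain T where T: "open T" "\<psi> ` V = half_space \<inter> T" using chart(2) by (auto simp: openin_open)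
  then obtain e where e: "e > 0" "ball (\<psi> q) e \<subseteq> T" using assms(1) openE by blast
  \<comment> \<open>Moves inwards along the first coordinate; the factor \<open>e / 2\<close> keeps
    also the first term inside the ball.\<close>
  define p where "p n = \<psi> q + (e / 2 * inverse (real (Suc n))) *\<^sub>R axis 1 1" for n
  have pW: "p n \<in> W" for n
  proof -
    have c: "0 < e / 2 * inverse (real (Suc n))" using e(1) by simp
    have "inverse (real (Suc n)) \<le> 1" by (simp add: field_simps)
    then have "e / 2 * inverse (real (Suc n)) \<le> e / 2 * 1" using e(1) by (intro mult_left_mono) auto
    then have "dist (\<psi> q) (p n) < e" using c e(1) by (simp add: p_def dist_norm)
    then have "p n \<in> T" using e(2) by auto
    moreover have "p n $ 1 > 0"
      using half_space_frontier[OF assms(2)] c by (simp add: p_def axis_def)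
    ultimately show ?thesis unfolding W_def half_space_interior T(2) by (simp add: half_space_def)
  qed
  have "p \<longlonglongrightarrow> \<psi> q + (e / 2 * 0) *\<^sub>R axis 1 1"
    unfolding p_def by (intro tendsto_intros LIMSEQ_inverse_real_of_nat)
  then have "p \<longlonglongrightarrow> \<psi> q" by simp
  with pW show ?thesis by (rule that)
qed

text \<open>The map \<zeta> wraps the factor \<open>C\<close> isometrically onto unit complex
  numbers: the identity for the circle, \<open>cis\<close> for the line. It may fail to be injective
  since only derivatives enter.\<close>

lemma nariai_no_conformal_boundary_patch:
  fixes C :: "'r::euclidean_space set" and \<zeta> :: "'r \<Rightarrow> complex"
  assumes \<Lambda>: "\<Lambda> > 0"
    and patches: "\<And>z. z \<in> C \<Longrightarrow> \<exists>U (\<phi> :: 'r \<Rightarrow> real) \<gamma>. parametrized_patch C U \<phi> \<gamma> \<and> z \<in> U"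
    and \<zeta>_Ck: "\<And>k. Ck_on k UNIV \<zeta>" and \<zeta>_unit: "\<And>z. z \<in> C \<Longrightarrow> norm (\<zeta> z) = 1"
    and \<zeta>_iso: "\<And>z a b. ddir \<zeta> a z \<bullet> ddir \<zeta> b z = a \<bullet> b"
  shows "\<not> has_conformal_boundary_patch TYPE('b) (top_of_set (nariai_space C)) (nariai_atlas C) (nariai_metric \<Lambda>)"
proof
  assume "has_conformal_boundary_patch TYPE('b) (top_of_set (nariai_space C)) (nariai_atlas C) (nariai_metric \<Lambda>)"
  then obtain X' :: "'b topology" and A' \<iota> g' \<Omega>
    where ext: "smooth_conformal_extension (top_of_set (nariai_space C)) (nariai_atlas C) (nariai_metric \<Lambda>) X' A' \<iota> g' \<Omega>"
    unfolding has_conformal_boundary_patch_def by blast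
  then have "mfd_boundary A' \<noteq> {}" unfolding smooth_conformal_extension_def by blast
  then obtain q where q: "q \<in> mfd_boundary A'" by blast
  then obtain V \<psi> where Vq: "(V, \<psi>) \<in> A'" "q \<in> V" "\<psi> q \<in> frontier half_space"
    unfolding mfd_boundary_def by blast
  interpret submanifold_extension "nariai_space C" "nariai_form \<Lambda>" X' A' \<iota> g' \<Omega> V \<psi>
    using ext Vq(1) nariai_atlas_covers[OF patches]
    by unfold_locales (simp_all add: nariai_atlas_def nariai_metric_def)
  obtain p where p: "\<And>n. p n \<in> W" "p \<longlonglongrightarrow> \<psi> q" using boundary_sequence[OF Vq(2,3)] by blast
  have qV: "\<psi> q \<in> \<psi> ` V" using Vq(2) by blast
  have \<sigma>q: "\<sigma> (\<psi> q) = q" using inj_\<psi> Vq(2) by (rule inv_into_f_f)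
  have WV: "W \<subseteq> \<psi> ` V" by (simp add: W_def)

  define O' where "O' x = \<Omega> (\<sigma> x)" for x
  \<comment> \<open>Absorbing \<Lambda> here rescales the physical metric to the product of unit
    hyperquadrics.\<close>
  define G where "G u v x = \<Lambda> * g' (V, \<psi>) (\<sigma> x) u v" for u v x
  define G0 where "G0 u v = \<Lambda> * g' (V, \<psi>) q u v" for u v
  have O'_smooth: "smooth_on (\<psi> ` V) O'"
    using ext_parts(4)[unfolded smooth_function_def, THEN bspec, OF Vq(1)] by (simp add: O'_def[abs_def] o_def)
  have g'_smooth: "smooth_on (\<psi> ` V) (\<lambda>x. g' (V, \<psi>) (\<sigma> x) u v)" for u v
    using ext_parts(3)[unfolded lorentzian_metric_def, THEN conjunct2, THEN conjunct1, THEN bspec, OF Vq(1)] by simp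
  have "linear (\<lambda>y. \<Lambda> * y)" by (auto intro!: linearI simp: algebra_simps)
  from smooth_on_compose[OF smooth_on_linear[OF this, of UNIV] g'_smooth subset_UNIV]
  have G_smooth: "smooth_on (\<psi> ` V) (G u v)" for u v
    unfolding G_def[abs_def] .
  have lor: "lorentzian_form (g' (V, \<psi>) r)" if "r \<in> V" for r
    using ext_parts(3)[unfolded lorentzian_metric_def, THEN conjunct1, THEN bspec, OF Vq(1)] that by simp
  have scaled: "bilinear (\<lambda>u v. \<Lambda> * g' (V, \<psi>) r u v)" "\<Lambda> * g' (V, \<psi>) r u v = \<Lambda> * g' (V, \<psi>) r v u"
    "(\<And>v. \<Lambda> * g' (V, \<psi>) r u v = 0) \<Longrightarrow> u = 0" if "r \<in> V" for r u v
  proof -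
    have b: "bilinear (g' (V, \<psi>) r)" and s: "\<And>u v. g' (V, \<psi>) r u v = g' (V, \<psi>) r v u"
      using lor[OF that] unfolding lorentzian_form_def by blast+
    have l: "linear (\<lambda>x. g' (V, \<psi>) r x y)" "linear (g' (V, \<psi>) r y)" for y using b by (auto simp: bilinear_def)
    show "bilinear (\<lambda>u v. \<Lambda> * g' (V, \<psi>) r u v)"
      unfolding bilinear_def
      by (auto intro!: linearI simp: linear_add[OF l(1)] linear_add[OF l(2)] linear_scale[OF l(1)]
          linear_scale[OF l(2)] algebra_simps)
    show "\<Lambda> * g' (V, \<psi>) r u v = \<Lambda> * g' (V, \<psi>) r v u" using s[of u v] by simp
    show "u = 0" if "\<And>v. \<Lambda> * g' (V, \<psi>) r u v = 0"
      using that \<Lambda> lorentzian_form_nondegenerate[OF lor[OF \<open>r \<in> V\<close>], of u] by simp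
  qed
  note limO = smooth_on_limits[OF O'_smooth qV WV open_W p]
  note limG = smooth_on_limits[OF G_smooth qV WV open_W p]
  obtain \<omega> where \<omega>: "linear \<omega>" "\<And>v. (\<lambda>n. ddir O' v (p n)) \<longlonglongrightarrow> \<omega> v" using limO(2) by blast
  have asym: "conformal_asymptotics W p O' G \<omega> G0"
  proof (rule conformal_asymptotics.intro)
    show "open W" by (rule open_W)
    show "p n \<in> W" for n by (rule p(1))
    show "Ck_on (Suc (Suc 0)) W O'" "Ck_on (Suc (Suc 0)) W (G u v)" for u v
      by (rule smooth_on_imp_Ck_on[OF smooth_on_subset[OF _ WV] open_W], rule O'_smooth G_smooth)+
    show "0 < O' x" if "x \<in> W" for x using ext_parts(5) \<sigma>_W(3)[OF that] by (simp add: O'_def)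
    show "bilinear (\<lambda>u v. G u v x)" if "x \<in> W" for x
      unfolding G_def by (rule scaled(1)[OF \<sigma>_W(1)[OF that]])
    show "G u v x = G v u x" if "x \<in> W" for x u v
      unfolding G_def by (rule scaled(2)[OF \<sigma>_W(1)[OF that]])
    show "u = 0" if "x \<in> W" "\<And>v. G u v x = 0" for x u
      using scaled(3)[OF \<sigma>_W(1)[OF that(1)], of u] that(2) by (simp add: G_def)
    show "bilinear G0" unfolding G0_def[abs_def] by (rule scaled(1)[OF Vq(2)])
    show "G0 u v = G0 v u" for u v unfolding G0_def by (rule scaled(2)[OF Vq(2)])
    show "u = 0" if "\<And>v. G0 u v = 0" for u
      using scaled(3)[OF Vq(2), of u] that by (simp add: G0_def)
    show "linear \<omega>" by (rule \<omega>(1))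
    show "(\<lambda>n. ddir O' v (p n)) \<longlonglongrightarrow> \<omega> v" for v by (rule \<omega>(2))
    show "(\<lambda>n. O' (p n)) \<longlonglongrightarrow> 0" using limO(1) ext_parts(6) q by (simp add: O'_def \<sigma>q)
    show "\<exists>l. (\<lambda>n. ddir (ddir O' v) w (p n)) \<longlonglongrightarrow> l" for v w by (rule limO(3))
    show "(\<lambda>n. G u v (p n)) \<longlonglongrightarrow> G0 u v" for u v using limG(1)[of u v] by (simp add: G_def G0_def \<sigma>q)
    show "\<exists>l. (\<lambda>n. ddir (G u v) c (p n)) \<longlonglongrightarrow> l" for u v c using limG(2)[of u v] by blast
    show "\<exists>l. (\<lambda>n. ddir (ddir (G u v) c) d (p n)) \<longlonglongrightarrow> l" for u v c d by (rule limG(3))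
  qed

  define t where "t x = fst (F x)" for x
  define z where "z x = fst (snd (F x))" for x
  define X where "X x = snd (snd (F x))" for x
  define w where "w x = \<zeta> (z x)" for x
  \<comment> \<open>The standard embedding of de Sitter space as a hyperboloid, with \<rho> entering
    through the point \<open>w x\<close> of the unit circle.\<close>
  define Y where "Y x = (sinh (t x), cosh (t x) *\<^sub>R w x)" for x
  have lin: "linear (fst :: real \<times> 'r \<times> (real^3) \<Rightarrow> _)" "linear (\<lambda>y :: real \<times> 'r \<times> (real^3). fst (snd y))"
      "linear (\<lambda>y :: real \<times> 'r \<times> (real^3). snd (snd y))" by (auto intro!: linearI)
  have Ck: "Ck_on k W t" "Ck_on k W z" "Ck_on k W X" for k
    unfolding t_def[abs_def] z_def[abs_def] X_def[abs_def]
    by (rule Ck_on_linear_compose[OF open_W _ F_Ck], rule lin)+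
  have Ck_w: "Ck_on k W w" for k
    unfolding w_def[abs_def] by (rule Ck_on_compose[OF open_W open_UNIV subset_UNIV \<zeta>_Ck Ck(2)])
  have Ck_sinh: "Ck_on k W (\<lambda>x. sinh (t x))" and Ck_cosh: "Ck_on k W (\<lambda>x. cosh (t x))" for k
    using Ck_on_sinh_cosh by (auto intro: Ck_on_compose[OF open_W open_UNIV subset_UNIV _ Ck(1)])
  have Ck_Y: "Ck_on k W Y" for k
    unfolding Y_def[abs_def] by (intro Ck_on_Pair Ck_on_scaleR open_W Ck_sinh Ck_cosh Ck_w)
  have unit_w: "norm (w x) = 1" and unit_X: "norm (X x) = 1" if "x \<in> W" for x
  proof -
    have "F x \<in> nariai_space C" by (rule F_continuous(2)[OF that])
    then show "norm (w x) = 1" "norm (X x) = 1"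
      by (auto simp: nariai_space_def w_def z_def X_def mem_Times_iff \<zeta>_unit)
  qed
  \<comment> \<open>Supplies the orthogonality of \<open>w\<close> and its derivatives, which
    removes the cross terms in the pullback.\<close>
  interpret w: unit_immersion W inner w
    using open_W Ck_w unit_w by (rule unit_immersion_inner)
  have X: "unit_immersion W inner X"
    using open_W Ck(3) unit_X by (rule unit_immersion_inner)
  have Y: "unit_immersion W minkowski Y"
  proof (rule unit_immersion.intro)
    show "minkowski (Y x) (Y x) = 1" if "x \<in> W" for x
    proof -
      have "minkowski (Y x) (Y x) = (cosh (t x))\<^sup>2 * (w x \<bullet> w x) - (sinh (t x))\<^sup>2"
        by (simp add: minkowski_def Y_def power2_eq_square)
      then show ?thesis using unit_w[OF that] cosh_square_eq[of "t x"] by (simp add: norm_eq_1)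
    qed
    show "minkowski a b = minkowski b a" for a b by (simp add: minkowski_def inner_commute)
  qed (rule open_W Ck_Y bounded_bilinear_minkowski)+
  have metric: "G u v x / (O' x)\<^sup>2 = pullback_form minkowski Y u v x + pullback_form inner X u v x"
    if x: "x \<in> W" for u v x
  proof -
    have dF: "F differentiable at x" using F_Ck[of "Suc 0"] x by simp
    have F_eq: "F x = (t x, z x, X x)" by (simp add: t_def z_def X_def)
    have ddF: "ddir F u x = (ddir t u x, ddir z u x, ddir X u x)" for u
      using ddir_linear_compose[OF lin(1) dF, of u] ddir_linear_compose[OF lin(2) dF, of u]
        ddir_linear_compose[OF lin(3) dF, of u]
      by (simp add: t_def[abs_def] z_def[abs_def] X_def[abs_def])
    have dw: "ddir w u x = ddir \<zeta> (ddir z u x) (z x)" for u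
      using diff_chain_at[OF Ck_on_SucD[OF Ck(2) x] Ck_on_SucD[OF \<zeta>_Ck UNIV_I]]
      by (intro ddir_eqI) (simp add: w_def[abs_def] o_def)
    have dY: "ddir Y u x = (cosh (t x) * ddir t u x,
        cosh (t x) *\<^sub>R ddir w u x + (sinh (t x) * ddir t u x) *\<^sub>R w x)" for u
    proof (rule ddir_eqI)
      have ds: "((\<lambda>x. sinh (t x)) has_derivative (\<lambda>u. cosh (t x) * ddir t u x)) (at x)"
        and dc: "((\<lambda>x. cosh (t x)) has_derivative (\<lambda>u. sinh (t x) * ddir t u x)) (at x)"
      proof -
        have "(sinh has_real_derivative cosh y) (at y)" "(cosh has_real_derivative sinh y) (at y)" for y :: real
          by (auto intro!: derivative_eq_intros)
        note d = this[of "t x"]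
        show "((\<lambda>x. sinh (t x)) has_derivative (\<lambda>u. cosh (t x) * ddir t u x)) (at x)"
          "((\<lambda>x. cosh (t x)) has_derivative (\<lambda>u. sinh (t x) * ddir t u x)) (at x)"
          using DERIV_compose_FDERIV[where g=t, OF d(1) Ck_on_SucD[OF Ck(1) x]]
            DERIV_compose_FDERIV[where g=t, OF d(2) Ck_on_SucD[OF Ck(1) x]]
          by (simp_all add: mult.commute)
      qed
      show "(Y has_derivative (\<lambda>u. (cosh (t x) * ddir t u x,
        cosh (t x) *\<^sub>R ddir w u x + (sinh (t x) * ddir t u x) *\<^sub>R w x))) (at x)"
        unfolding Y_def[abs_def]
        by (intro has_derivative_Pair ds has_derivative_scaleR[OF dc Ck_on_SucD[OF Ck_w x]])
    qed
    have ww: "w x \<bullet> w x = 1" using unit_w[OF x] by (simp add: norm_eq_1)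
    have wd: "w x \<bullet> ddir w u x = 0" "ddir w u x \<bullet> w x = 0" for u
      using w.tangent_orthogonal[OF x] by (simp_all add: inner_commute)
    have "pullback_form minkowski Y u v x = (cosh (t x))\<^sup>2 * (ddir z u x \<bullet> ddir z v x)
        + ((sinh (t x))\<^sup>2 - (cosh (t x))\<^sup>2) * (ddir t u x * ddir t v x)"
      unfolding dY minkowski_def
      by (simp add: inner_add_left inner_add_right ww wd power2_eq_square algebra_simps)
         (simp add: dw \<zeta>_iso)
    also have "(sinh (t x))\<^sup>2 - (cosh (t x))\<^sup>2 = - 1" using cosh_square_eq[of "t x"] by simp
    finally have pY: "pullback_form minkowski Y u v x
        = (cosh (t x))\<^sup>2 * (ddir z u x \<bullet> ddir z v x) - ddir t u x * ddir t v x" by simp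
    have "G u v x / (O' x)\<^sup>2 = \<Lambda> * nariai_form \<Lambda> (F x) (ddir F u x) (ddir F v x)"
      using F_pullback[OF x, of u v] by (simp add: G_def O'_def)
    also have "\<dots> = - (ddir t u x * ddir t v x) + (cosh (t x))\<^sup>2 * (ddir z u x \<bullet> ddir z v x) + ddir X u x \<bullet> ddir X v x"
      unfolding ddF F_eq using \<Lambda> by simp
    finally show ?thesis unfolding pY by simp
  qed
  \<comment> \<open>The dimension conditions are 3 + 3 = 4 + 2 and 3 + 1 \<le> 4.\<close>
  show False
    by (rule no_conformal_infinity_of_product[OF asym Y X _ _ _ metric]) simp_all
qed

theorem proposition5:
  fixes \<Lambda> :: real
  assumes "\<Lambda> > 0"
  shows "\<not> has_conformal_boundary_patch TYPE('b)
            (top_of_set (nariai_space (sphere (0::complex) 1)))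
            (nariai_atlas (sphere (0::complex) 1)) (nariai_metric \<Lambda>)
       \<and> \<not> has_conformal_boundary_patch TYPE('b)
            (top_of_set (nariai_space (UNIV :: real set)))
            (nariai_atlas (UNIV :: real set)) (nariai_metric \<Lambda>)"
proof
  show "\<not> has_conformal_boundary_patch TYPE('b)
            (top_of_set (nariai_space (sphere (0::complex) 1)))
            (nariai_atlas (sphere (0::complex) 1)) (nariai_metric \<Lambda>)"
    by (rule nariai_no_conformal_boundary_patch[where \<zeta>="\<lambda>z. z", OF assms circle_patches])
      (auto intro: Ck_on_linear linear_ident simp del: Ck_on.simps)
  have cis_Ck: "Ck_on k UNIV (cis :: real \<Rightarrow> complex)" for k
  proof -
    have "Ck_on k UNIV (\<lambda>\<rho>::real. cos \<rho> *\<^sub>R (1::complex) + sin \<rho> *\<^sub>R \<i>)"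
      using Ck_on_sin_cos by (intro Ck_on_add Ck_on_scaleR Ck_on_const) auto
    moreover have "(\<lambda>\<rho>::real. cos \<rho> *\<^sub>R (1::complex) + sin \<rho> *\<^sub>R \<i>) = cis"
      by (simp add: fun_eq_iff complex_eq_iff)
    ultimately show ?thesis by simp
  qed
  have cis_deriv: "ddir cis a \<rho> = a *\<^sub>R (\<i> * cis \<rho>)" for a \<rho> :: real
  proof (rule ddir_eqI)
    show "(cis has_derivative (\<lambda>a. a *\<^sub>R (\<i> * cis \<rho>))) (at \<rho>)"
      using has_derivative_cis[OF has_derivative_ident, of \<rho> UNIV] by simp
  qed
  have cis_iso: "ddir cis a \<rho> \<bullet> ddir cis b \<rho> = a \<bullet> b" for a b \<rho> :: real
  proof -
    have "(\<i> * cis \<rho>) \<bullet> (\<i> * cis \<rho>) = 1"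
      using norm_eq_1[of "\<i> * cis \<rho>"] by (simp add: norm_mult)
    then show ?thesis by (simp add: cis_deriv)
  qed
  show "\<not> has_conformal_boundary_patch TYPE('b)
            (top_of_set (nariai_space (UNIV :: real set)))
            (nariai_atlas (UNIV :: real set)) (nariai_metric \<Lambda>)"
    by (rule nariai_no_conformal_boundary_patch[where \<zeta>=cis, OF assms _ cis_Ck _ cis_iso])
      (use parametrized_patch_UNIV in blast, simp)
qed

end
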